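(* Let $H$ be a separable infinite-dimensional complex Hilbert space, let $F(H)$ be the set of finite rank operators on $H$, and let $\varphi_\alpha$ be the non-linear trace of the Choquet type associated with a monotone increasing function $\alpha:\mathbb{N}_0=\mathbb{N}\cup\{0\}\to[0,\infty)$ with $\alpha(0)=0$ and $\alpha(1)>0$. For $0<p<\infty$ define $|||a|||_{\alpha,p}:=\varphi_\alpha(|a|^p)^{1/p}$ for $a\in F(H)$. Then the following conditions are equivalent: \begin{enumerate} \item[(1)] There exists a positive number $M$ such that $\varphi_\alpha(|a+b|)\le M\bigl(\varphi_\alpha(|a|)+\varphi_\alpha(|b|)\bigr)$ for any $a,b\in F(H)$. \item[(2)] The sequence $\left(\dfrac{\alpha(2n)}{\alpha(n)}\right)_{n\ge1}$ is bounded. \item[(3)] $|||\cdot|||_{\alpha,p}$ is a quasi-norm on $F(H)$ for any $p\ge1$. \item[(4)] $|||\cdot|||_{\alpha,p}$ is a quasi-norm on $F(H)$ for any $0<p<1$. \item[(5)] $|||\cdot|||_{\alpha,p}$ is a quasi-norm on $F(H)$ for some $p>0$. \end{enumerate}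
   Context: "Monotone increasing" means non-decreasing. $K(H)$ denotes the compact operators on $H$ and $K(H)^+$ the positive compact operators. For $a\in K(H)^+$, $\lambda_1(a)\ge\lambda_2(a)\ge\cdots$ denotes the list of eigenvalues of $a$ in decreasing order counted with multiplicity (if $a$ has finite rank, the list of non-zero eigenvalues is completed by zeros; if $a$ is not of finite rank, every $\lambda_n(a)\neq0$). The non-linear trace of the Choquet type associated with $\alpha$ is $\varphi_\alpha:K(H)^+\to[0,\infty]$, $$\varphi_\alpha(a)=\sum_{i=1}^\infty(\lambda_i(a)-\lambda_{i+1}(a))\,\alpha(i)=\sum_{i=1}^\infty\lambda_i(a)\,(\alpha(i)-\alpha(i-1)).$$ $|a|=(a^*a)^{1/2}$. Quasi-norm: a function $\varphi$ on a complex vector space $X$ is a quasi-norm if there is a constant $c>1$ such that for all $x,y\in X$ and $\gamma\in\mathbb{C}$: $\varphi(x)\ge0$, $\varphi(\gamma x)=|\gamma|\varphi(x)$, and $\varphi(x+y)\le c(\varphi(x)+\varphi(y))$. *)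

theory Defs
  imports "HOL-Analysis.Analysis" "HOL-Library.Function_Algebras"
begin

section \<open>Complex vector spaces and complex Hilbert spaces\<close>

class complex_vector = real_vector +
  fixes scaleC :: "complex \<Rightarrow> 'a \<Rightarrow> 'a"  (infixr \<open>*\<^sub>C\<close> 75)
  assumes scaleC_add_right: "c *\<^sub>C (x + y) = c *\<^sub>C x + c *\<^sub>C y"
    and scaleC_add_left: "(c + d) *\<^sub>C x = c *\<^sub>C x + d *\<^sub>C x"
    and scaleC_scaleC: "c *\<^sub>C d *\<^sub>C x = (c * d) *\<^sub>C x"
    and scaleC_one: "1 *\<^sub>C x = x"
    and scaleR_scaleC: "r *\<^sub>R x = complex_of_real r *\<^sub>C x"

global_interpretation complex_vector: vector_space "scaleC :: complex \<Rightarrow> 'a \<Rightarrow> 'a::complex_vector"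
  defines csubspace = complex_vector.subspace
    and cspan = complex_vector.span
    and cdim = complex_vector.dim
  by unfold_locales
     (simp_all add: scaleC_add_right scaleC_add_left scaleC_scaleC scaleC_one)

text \<open>The inner product is linear in the second argument.\<close>

class complex_hilbert = complex_vector + banach +
  fixes cinner :: "'a \<Rightarrow> 'a \<Rightarrow> complex"
  assumes cinner_commute: "cinner x y = cnj (cinner y x)"
    and cinner_add_right: "cinner x (y + z) = cinner x y + cinner x z"
    and cinner_scaleC_right: "cinner x (c *\<^sub>C y) = c * cinner x y"
    and cinner_self: "cinner x x = complex_of_real ((norm x)\<^sup>2)"

text \<open>Operators are plain functions with the pointwise vector space operations; addition
  comes from Function_Algebras.\<close>

instantiation "fun" :: (type, real_vector) real_vector
begin
definition scaleR_fun :: "real \<Rightarrow> ('a \<Rightarrow> 'b) \<Rightarrow> 'a \<Rightarrow> 'b" where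
  "scaleR_fun r f = (\<lambda>x. r *\<^sub>R f x)"
instance
  by standard (auto simp: scaleR_fun_def fun_eq_iff scaleR_add_right scaleR_add_left)
end

instantiation "fun" :: (type, complex_vector) complex_vector
begin
definition scaleC_fun :: "complex \<Rightarrow> ('a \<Rightarrow> 'b) \<Rightarrow> 'a \<Rightarrow> 'b" where
  "scaleC_fun c f = (\<lambda>x. c *\<^sub>C f x)"
instance
  by standard (auto simp: scaleC_fun_def scaleR_fun_def fun_eq_iff scaleC_add_right
      scaleC_add_left scaleC_scaleC scaleC_one scaleR_scaleC)
end


section \<open>Operators\<close>

definition bounded_clinear :: "('a::complex_hilbert \<Rightarrow> 'a) \<Rightarrow> bool" where
  "bounded_clinear a \<longleftrightarrow> bounded_linear a \<and> (\<forall>c x. a (c *\<^sub>C x) = c *\<^sub>C a x)"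

definition finite_rank_ops :: "('a::complex_hilbert \<Rightarrow> 'a) set" where
  "finite_rank_ops = {a. bounded_clinear a \<and> (\<exists>B. finite B \<and> range a \<subseteq> cspan B)}"

definition cadjoint :: "('a::complex_hilbert \<Rightarrow> 'a) \<Rightarrow> 'a \<Rightarrow> 'a" where
  "cadjoint a = (THE b. bounded_clinear b \<and> (\<forall>x y. cinner (a x) y = cinner x (b y)))"

text \<open>Functional calculus \<open>f(b)\<close> of a positive compact operator \<open>b\<close>, for \<open>f\<close> continuous on
  \<open>[0,\<infinity>)\<close>: if \<open>b = (\<Sum>i. \<lambda>\<^sub>i P\<^sub>i)\<close> is the spectral decomposition, then \<open>f(b)\<close> is the bounded
  operator that acts on each eigenspace \<open>ker (b - \<lambda>)\<close>, including \<open>ker b\<close>, as multiplication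
  by \<open>f \<lambda>\<close>.  The eigenspaces of \<open>b\<close> span a dense subspace, so this operator is unique.\<close>

definition fun_calc :: "(real \<Rightarrow> real) \<Rightarrow> ('a::complex_hilbert \<Rightarrow> 'a) \<Rightarrow> 'a \<Rightarrow> 'a" where
  "fun_calc f b =
    (THE c. bounded_clinear c \<and> (\<forall>\<mu> x. b x = \<mu> *\<^sub>R x \<longrightarrow> c x = f \<mu> *\<^sub>R x))"

text \<open>\<open>0 powr p = 0\<close>, so for \<open>p > 0\<close> the function used here is \<open>t\<^sup>p\<close> on \<open>[0,\<infinity>)\<close>.\<close>

definition op_powr :: "('a::complex_hilbert \<Rightarrow> 'a) \<Rightarrow> real \<Rightarrow> 'a \<Rightarrow> 'a" where
  "op_powr b p = fun_calc (\<lambda>t. t powr p) b"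

definition op_abs :: "('a::complex_hilbert \<Rightarrow> 'a) \<Rightarrow> 'a \<Rightarrow> 'a" where
  "op_abs a = op_powr (cadjoint a \<circ> a) (1/2)"


section \<open>Eigenvalue lists and non-linear traces of the Choquet type\<close>

text \<open>\<open>l\<close> is the decreasing list of eigenvalues of the positive compact operator \<open>b\<close>: every
  positive number occurs in it exactly as often as its multiplicity as an eigenvalue.
  Entries are nonnegative, so if \<open>b\<close> has finite rank the list is completed by zeros.  If \<open>b\<close>
  has infinite rank, infinitely many entries are positive, and as the list is decreasing no
  entry is zero.  Finiteness is demanded because \<open>card\<close> is \<open>0\<close> on infinite sets.\<close>

definition is_eigenvalue_list :: "('a::complex_hilbert \<Rightarrow> 'a) \<Rightarrow> (nat \<Rightarrow> real) \<Rightarrow> bool" where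
  "is_eigenvalue_list b l \<longleftrightarrow> antimono l \<and> (\<forall>n. 0 \<le> l n) \<and>
    (\<forall>\<mu>>0. finite {n. l n = \<mu>} \<and> card {n. l n = \<mu>} = cdim {x. b x = \<mu> *\<^sub>R x})"

text \<open>Indices start at \<open>0\<close>: \<open>eigenvalue b n\<close> is \<open>\<lambda>\<^sub>n\<^sub>+\<^sub>1(b)\<close>.\<close>

definition eigenvalue :: "('a::complex_hilbert \<Rightarrow> 'a) \<Rightarrow> nat \<Rightarrow> real" where
  "eigenvalue b = (THE l. is_eigenvalue_list b l)"

text \<open>\<open>\<phi>\<^sub>\<alpha>(b)\<close> for a positive compact operator \<open>b\<close>; all terms of the series are nonnegative.\<close>

definition choquet_trace :: "(nat \<Rightarrow> real) \<Rightarrow> ('a::complex_hilbert \<Rightarrow> 'a) \<Rightarrow> ennreal" where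
  "choquet_trace \<alpha> b =
    (\<Sum>n. ennreal ((eigenvalue b n - eigenvalue b (Suc n)) * \<alpha> (Suc n)))"

text \<open>For \<open>a\<close> of finite rank the trace is a finite sum, so \<open>enn2real\<close> does not lose
  information.\<close>

definition choquet_norm :: "(nat \<Rightarrow> real) \<Rightarrow> real \<Rightarrow> ('a::complex_hilbert \<Rightarrow> 'a) \<Rightarrow> real" where
  "choquet_norm \<alpha> p a = enn2real (choquet_trace \<alpha> (op_powr (op_abs a) p)) powr (1 / p)"


section \<open>Quasi-norms\<close>

text \<open>Definiteness is not part of the notion.\<close>

definition quasi_norm_on :: "'v::complex_vector set \<Rightarrow> ('v \<Rightarrow> real) \<Rightarrow> bool" where
  "quasi_norm_on X \<phi> \<longleftrightarrow> (\<exists>c>1. \<forall>x\<in>X. \<forall>y\<in>X. \<forall>\<gamma>.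
     0 \<le> \<phi> x \<and> \<phi> (\<gamma> *\<^sub>C x) = cmod \<gamma> * \<phi> x \<and> \<phi> (x + y) \<le> c * (\<phi> x + \<phi> y))"

lemma csubspace_finite_rank_ops: "csubspace (finite_rank_ops :: ('a::complex_hilbert \<Rightarrow> 'a) set)"
proof (rule complex_vector.subspaceI)
  show "(0::'a \<Rightarrow> 'a) \<in> finite_rank_ops"
    by (auto simp: finite_rank_ops_def bounded_clinear_def zero_fun_def
        complex_vector.span_zero intro!: exI[of _ "{}"] complex_vector.scale_zero_right[symmetric])
next
  fix a b :: "'a \<Rightarrow> 'a"
  assume "a \<in> finite_rank_ops" "b \<in> finite_rank_ops"
  then obtain B C where *: "bounded_clinear a" "bounded_clinear b" "finite B" "finite C"
      "range a \<subseteq> cspan B" "range b \<subseteq> cspan C"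
    by (auto simp: finite_rank_ops_def)
  have "range (a + b) \<subseteq> cspan (B \<union> C)"
    using *(5,6) complex_vector.span_mono[of B "B \<union> C"] complex_vector.span_mono[of C "B \<union> C"]
    by (auto simp: plus_fun_def intro!: complex_vector.span_add)
  then show "a + b \<in> finite_rank_ops"
    using * by (auto simp: finite_rank_ops_def bounded_clinear_def plus_fun_def
        scaleC_add_right bounded_linear_add intro!: exI[of _ "B \<union> C"])
next
  fix c and a :: "'a \<Rightarrow> 'a"
  assume "a \<in> finite_rank_ops"
  then obtain B where *: "bounded_clinear a" "finite B" "range a \<subseteq> cspan B"
    by (auto simp: finite_rank_ops_def)
  have norm: "norm (c *\<^sub>C x) = cmod c * norm x" for x :: 'a
  proof -
    have "cinner (c *\<^sub>C x) (c *\<^sub>C x) = c * cnj (cinner x (c *\<^sub>C x))"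
      by (metis cinner_commute cinner_scaleC_right)
    also have "\<dots> = complex_of_real ((cmod c * norm x)\<^sup>2)"
      by (simp add: cinner_scaleC_right cinner_self power_mult_distrib
          complex_norm_square[symmetric] flip: mult.assoc)
    finally have "(norm (c *\<^sub>C x))\<^sup>2 = (cmod c * norm x)\<^sup>2"
      by (metis cinner_self of_real_eq_iff)
    then show ?thesis by (simp add: power2_eq_iff_nonneg)
  qed
  have "bounded_linear (\<lambda>x::'a. c *\<^sub>C x)"
    by (rule bounded_linear_intro[where K = "cmod c"])
       (simp_all add: scaleC_add_right scaleR_scaleC scaleC_scaleC norm mult.commute)
  then have "bounded_linear (\<lambda>x. c *\<^sub>C a x)"
    using * by (auto simp: bounded_clinear_def intro: bounded_linear_compose)
  moreover have "range (\<lambda>x. c *\<^sub>C a x) \<subseteq> cspan B"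
    using * by (auto intro!: complex_vector.span_scale)
  ultimately show "c *\<^sub>C a \<in> finite_rank_ops"
    using * by (auto simp: finite_rank_ops_def bounded_clinear_def scaleC_fun_def
        scaleC_scaleC mult.commute)
qed

end

theory Submission
  imports Defs
begin

text \<open>By Abel summation \<open>\<phi>\<^sub>\<alpha>(|a|\<^sup>p)\<close> is the sum of \<open>s\<^sub>i(a)\<^sup>p (\<alpha>(i) - \<alpha>(i - 1))\<close> over the singular values
  of \<open>a\<close>, hence monotone and additive in the sequence of the \<open>s\<^sub>i(a)\<^sup>p\<close>.  The inequality
  \<open>s\<^bsub>2i-1\<^esub>(a + b) \<le> s\<^sub>i(a) + s\<^sub>i(b)\<close> compares the sequence of \<open>a + b\<close> with those of \<open>a\<close> and \<open>b\<close> in which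
  every entry is repeated twice, and repeating entries replaces \<open>\<alpha>(n)\<close> by \<open>\<alpha>(2n) \<le> C \<alpha>(n)\<close>.
  Conversely, two orthogonal projections of rank \<open>n\<close> have traces \<open>\<alpha>(n)\<close> and their sum has trace
  \<open>\<alpha>(2n)\<close>, whatever \<open>p\<close> is.\<close>

section \<open>Inner products and orthonormal families\<close>

text \<open>Adjoint, functional calculus and eigenvalue list are defined by unique description, so
  nothing can be computed before existence and uniqueness are known. Finite rank makes this
  elementary: the spectral theorem turns the product of the adjoint with \<open>a\<close> into a
  finite orthonormal sum \<open>diag_op n e s\<close>, from which powers, eigenvalue list and trace
  can be read off. As \<open>\<alpha>\<close> need not be concave, one cannot hope for a triangle
  inequality with constant 1. The loss has two sources: the shift of indices, paid by
  \<open>C\<close>, and the power of a sum, paid by (x + y)^p <= 2^p (x^p + y^p). The latter holds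
  on both sides of p = 1 and serves again, with 1/p, for the final root; hence no case distinction
  on p. In the converse direction all positive powers of a projection coincide, which is why a
  single exponent recovers (2).\<close>

lemma mult_cnj_cmod: "z * cnj z = (complex_of_real (cmod z))\<^sup>2"
  using complex_norm_square[of z] by simp

lemma cinner_add_left: "cinner (x + y) (z::'a::complex_hilbert) = cinner x z + cinner y z"
  by (subst (1 2 3) cinner_commute) (simp add: cinner_add_right)

lemma cinner_scaleC_left: "cinner (c *\<^sub>C x) (y::'a::complex_hilbert) = cnj c * cinner x y"
  by (subst (1 2) cinner_commute) (simp add: cinner_scaleC_right)

lemma cinner_zero_right [simp]: "cinner x (0::'a::complex_hilbert) = 0"
  using cinner_scaleC_right[of x 0 0] by simp

lemma cinner_zero_left [simp]: "cinner (0::'a::complex_hilbert) x = 0"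
  using cinner_scaleC_left[of 0 0 x] by simp

lemma cinner_minus_right: "cinner x (- y::'a::complex_hilbert) = - cinner x y"
  by (metis add.right_inverse add_eq_0_iff cinner_add_right cinner_zero_right)

lemma cinner_minus_left: "cinner (- x::'a::complex_hilbert) y = - cinner x y"
  by (metis add.right_inverse add_eq_0_iff cinner_add_left cinner_zero_left)

lemma cinner_diff_right: "cinner x (y - z::'a::complex_hilbert) = cinner x y - cinner x z"
  by (simp only: diff_conv_add_uminus cinner_add_right cinner_minus_right)

lemma cinner_diff_left: "cinner (x - y::'a::complex_hilbert) z = cinner x z - cinner y z"
  by (simp only: diff_conv_add_uminus cinner_add_left cinner_minus_left)

lemma cinner_sum_right: "cinner x (\<Sum>i\<in>I. f i::'a::complex_hilbert) = (\<Sum>i\<in>I. cinner x (f i))"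
  by (induction I rule: infinite_finite_induct) (simp_all add: cinner_add_right)

lemma cinner_sum_left: "cinner (\<Sum>i\<in>I. f i::'a::complex_hilbert) x = (\<Sum>i\<in>I. cinner (f i) x)"
  by (induction I rule: infinite_finite_induct) (simp_all add: cinner_add_left)

lemmas cinner_linear = cinner_add_left cinner_add_right cinner_diff_left cinner_diff_right
  cinner_minus_left cinner_minus_right cinner_scaleC_left cinner_scaleC_right
  cinner_sum_left cinner_sum_right

lemma Re_cinner_self: "Re (cinner x x) = (norm (x::'a::complex_hilbert))\<^sup>2"
  by (simp add: cinner_self)

lemma Re_cinner_commute: "Re (cinner x y) = Re (cinner y (x::'a::complex_hilbert))"
  by (subst cinner_commute) simp

lemma cinner_nondegenerate: "(\<And>y. cinner y (x::'a::complex_hilbert) = 0) \<Longrightarrow> x = 0"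
  using Re_cinner_self[of x] by simp

lemma cinner_ext:
  assumes "\<And>z. cinner z (x::'a::complex_hilbert) = cinner z y"
  shows "x = y"
  using cinner_nondegenerate[of "x - y"] assms by (simp add: cinner_diff_right)

lemma norm_scaleC: "norm (c *\<^sub>C (x::'a::complex_hilbert)) = cmod c * norm x"
proof -
  have "complex_of_real ((norm (c *\<^sub>C x))\<^sup>2) = complex_of_real ((cmod c * norm x)\<^sup>2)"
    unfolding cinner_self[symmetric] cinner_linear
    by (simp add: cinner_self power_mult_distrib mult_cnj_cmod flip: mult.assoc)
  then have "(norm (c *\<^sub>C x))\<^sup>2 = (cmod c * norm x)\<^sup>2"
    by (simp only: of_real_eq_iff)
  then show ?thesis by (simp add: power2_eq_iff_nonneg)
qed

lemma norm_add_sq: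
  "(norm (x + y::'a::complex_hilbert))\<^sup>2 = (norm x)\<^sup>2 + 2 * Re (cinner x y) + (norm y)\<^sup>2"
  using Re_cinner_commute[of x y]
  by (simp flip: Re_cinner_self add: cinner_linear)

lemma norm_diff_sq:
  "(norm (x - y::'a::complex_hilbert))\<^sup>2 = (norm x)\<^sup>2 - 2 * Re (cinner x y) + (norm y)\<^sup>2"
  using norm_add_sq[of x "- y"] by (simp add: cinner_minus_right)

text \<open>Only the first \<open>n\<close> values of the family count, so a family is extended by a
  function update at \<open>n\<close>.\<close>

definition orthonormal :: "nat \<Rightarrow> (nat \<Rightarrow> 'a::complex_hilbert) \<Rightarrow> bool" where
  "orthonormal n e \<longleftrightarrow> (\<forall>i<n. \<forall>j<n. cinner (e i) (e j) = (if i = j then 1 else 0))"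

text \<open>For orthonormal \<open>e\<close> this is a finite spectral decomposition. Coefficients
  may vanish, so \<open>n\<close> only bounds the rank, and the operator is zero on the complement
  of the family.\<close>

definition diag_op :: "nat \<Rightarrow> (nat \<Rightarrow> 'a::complex_hilbert) \<Rightarrow> (nat \<Rightarrow> real) \<Rightarrow> 'a \<Rightarrow> 'a" where
  "diag_op n e s x = (\<Sum>i<n. (complex_of_real (s i) * cinner (e i) x) *\<^sub>C e i)"

abbreviation proj_op :: "nat \<Rightarrow> (nat \<Rightarrow> 'a::complex_hilbert) \<Rightarrow> 'a \<Rightarrow> 'a" where
  "proj_op n e \<equiv> diag_op n e (\<lambda>_. 1)"

lemma orthonormal_cinner_sum:
  assumes "orthonormal n e" "j < n"
  shows "cinner (e j) (\<Sum>i<n. c i *\<^sub>C e i) = c j"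
proof -
  have "cinner (e j) (\<Sum>i<n. c i *\<^sub>C e i) = (\<Sum>i<n. if i = j then c j else 0)"
    unfolding cinner_linear using assms by (intro sum.cong) (auto simp: orthonormal_def)
  then show ?thesis using assms by simp
qed

lemma cinner_diag_op:
  assumes "orthonormal n e" "j < n"
  shows "cinner (e j) (diag_op n e s x) = s j * cinner (e j) x"
  unfolding diag_op_def using assms by (rule orthonormal_cinner_sum)

lemma norm_orthonormal_sum:
  assumes "orthonormal n e"
  shows "(norm (\<Sum>i<n. c i *\<^sub>C e i))\<^sup>2 = (\<Sum>i<n. (cmod (c i))\<^sup>2)"
proof -
  have "cinner (\<Sum>i<n. c i *\<^sub>C e i) (\<Sum>i<n. c i *\<^sub>C e i)
      = (\<Sum>i<n. cnj (c i) * cinner (e i) (\<Sum>i<n. c i *\<^sub>C e i))"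
    by (simp only: cinner_sum_left[of _ _ "sum _ _"] cinner_scaleC_left)
  also have "\<dots> = (\<Sum>i<n. complex_of_real ((cmod (c i))\<^sup>2))"
    by (intro sum.cong)
       (simp_all add: orthonormal_cinner_sum[OF assms] mult_cnj_cmod mult.commute[of "cnj _"])
  finally show ?thesis by (simp flip: Re_cinner_self)
qed

lemma cinner_diag_op_right:
  "cinner y (diag_op n e s x) = (\<Sum>i<n. s i * (cnj (cinner (e i) y) * cinner (e i) x))"
  unfolding diag_op_def cinner_linear
  by (intro sum.cong) (use cinner_commute[of y] in \<open>auto simp: mult_ac\<close>)

lemma diag_op_selfadjoint: "cinner (diag_op n e s x) y = cinner x (diag_op n e s y)"
  by (subst cinner_commute) (simp add: cinner_diag_op_right mult_ac)

lemma Re_cinner_diag_op: "Re (cinner x (diag_op n e s x)) = (\<Sum>i<n. s i * (cmod (cinner (e i) x))\<^sup>2)"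
  unfolding cinner_diag_op_right Re_sum
  by (intro sum.cong) (simp_all add: cmod_power2 flip: power2_eq_square)

text \<open>The squared norm of the residual \<open>x - proj_op n e x\<close> is nonnegative; expand
  it.\<close>

lemma bessel:
  assumes "orthonormal n e"
  shows "(\<Sum>i<n. (cmod (cinner (e i) x))\<^sup>2) \<le> (norm x)\<^sup>2"
proof -
  have "(norm (proj_op n e x))\<^sup>2 = (\<Sum>i<n. (cmod (cinner (e i) x))\<^sup>2)"
    using norm_orthonormal_sum[OF assms, of "\<lambda>i. cinner (e i) x"] by (simp add: diag_op_def)
  then have "(norm (x - proj_op n e x))\<^sup>2 = (norm x)\<^sup>2 - (\<Sum>i<n. (cmod (cinner (e i) x))\<^sup>2)"
    by (simp add: norm_diff_sq Re_cinner_diag_op)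
  then show ?thesis by (metis diff_ge_0_iff_ge zero_le_power2)
qed

lemma orthonormal_1: "norm u = 1 \<Longrightarrow> orthonormal 1 (\<lambda>_. u)"
  by (simp add: orthonormal_def cinner_self)

text \<open>Bessel's inequality for the one-element family formed by the normalised
  \<open>x\<close>.\<close>

lemma cinner_cauchy_schwarz: "cmod (cinner x y) \<le> norm x * norm (y::'a::complex_hilbert)"
proof (cases "x = 0")
  case False
  define u where "u = complex_of_real (1 / norm x) *\<^sub>C x"
  have "norm u = 1" using False by (simp add: u_def norm_scaleC norm_divide)
  then have "(cmod (cinner u y))\<^sup>2 \<le> (norm y)\<^sup>2"
    using bessel[of 1 "\<lambda>_. u" y] orthonormal_1[of u] by simp
  then have "cmod (cinner u y) \<le> norm y" by (simp add: power2_le_iff_abs_le)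
  moreover have "cmod (cinner u y) = cmod (cinner x y) / norm x"
    by (simp add: u_def cinner_scaleC_left norm_divide)
  ultimately show ?thesis using False by (simp add: field_simps)
qed simp

lemma bounded_bilinear_cinner: "bounded_bilinear (cinner :: 'a::complex_hilbert \<Rightarrow> 'a \<Rightarrow> complex)"
proof
  show "\<exists>K. \<forall>(x::'a) y. norm (cinner x y) \<le> norm x * norm y * K"
    by (rule exI[of _ 1]) (simp add: cinner_cauchy_schwarz)
qed (simp_all add: cinner_linear scaleR_scaleC scaleR_conv_of_real)


section \<open>Linear maps\<close>

lemma bounded_clinear_simps:
  assumes "bounded_clinear b"
  shows "b (x + y) = b x + b y" "b (x - y) = b x - b y" "b (- x) = - b x" "b 0 = 0"
    "b (c *\<^sub>C x) = c *\<^sub>C b x" "b (r *\<^sub>R x) = r *\<^sub>R b x" "b (sum f I) = (\<Sum>i\<in>I. b (f i))"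
proof -
  interpret bounded_linear b using assms by (simp add: bounded_clinear_def)
  show "b (x + y) = b x + b y" "b (x - y) = b x - b y" "b (- x) = - b x" "b 0 = 0"
    "b (c *\<^sub>C x) = c *\<^sub>C b x" "b (r *\<^sub>R x) = r *\<^sub>R b x" "b (sum f I) = (\<Sum>i\<in>I. b (f i))"
    using assms by (simp_all add: add diff neg zero scaleR sum bounded_clinear_def)
qed

lemma bounded_linear_scaleC_left: "bounded_linear (\<lambda>c. c *\<^sub>C (x::'a::complex_hilbert))"
  by (rule bounded_linear_intro[where K = "norm x"])
     (simp_all add: scaleC_add_left scaleR_scaleC scaleC_scaleC norm_scaleC scaleR_conv_of_real)

text \<open>Covers \<open>diag_op\<close> and also adjoints, for which the families \<open>v\<close>
  and \<open>w\<close> differ.\<close>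

lemma bounded_clinear_sum_cinner:
  "bounded_clinear (\<lambda>x. \<Sum>i\<in>I. (c i * cinner (v i) x) *\<^sub>C (w i::'a::complex_hilbert))"
proof -
  have "bounded_linear (\<lambda>x. (c i * cinner (v i) x) *\<^sub>C w i)" for i
    by (intro bounded_linear_compose[OF bounded_linear_scaleC_left]
        bounded_linear_compose[OF bounded_linear_mult_right]
        bounded_bilinear.bounded_linear_right[OF bounded_bilinear_cinner])
  then show ?thesis
    unfolding bounded_clinear_def
    by (auto intro!: bounded_linear_sum sum.cong
        simp: cinner_linear complex_vector.scale_sum_right scaleC_scaleC mult_ac)
qed

lemma bounded_clinear_diag_op: "bounded_clinear (diag_op n e s)"
  using bounded_clinear_sum_cinner[of "\<lambda>i. complex_of_real (s i)" e e "{..<n}"]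
  by (simp add: diag_op_def[abs_def])

lemma diag_op_finite_rank: "diag_op n e s \<in> finite_rank_ops"
  unfolding finite_rank_ops_def
  by (auto simp: bounded_clinear_diag_op diag_op_def intro!: exI[of _ "e ` {..<n}"]
      complex_vector.span_sum complex_vector.span_scale intro: complex_vector.span_base)

lemma bounded_clinear_compose:
  "bounded_clinear a \<Longrightarrow> bounded_clinear b \<Longrightarrow> bounded_clinear (a \<circ> b)"
  by (auto simp: bounded_clinear_def o_def intro: bounded_linear_compose)

lemma bounded_clinear_diff:
  "bounded_clinear a \<Longrightarrow> bounded_clinear b \<Longrightarrow> bounded_clinear (\<lambda>x. a x - b x)"
  by (auto simp: bounded_clinear_def complex_vector.scale_right_diff_distrib intro: bounded_linear_sub)

lemma bounded_clinear_scaleR: "bounded_clinear (\<lambda>x::'a::complex_hilbert. r *\<^sub>R x)"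
  unfolding bounded_clinear_def
  by (intro conjI bounded_linear_scaleR_right allI) (simp add: scaleR_scaleC scaleC_scaleC mult.commute)

lemma finite_rank_opsD: "a \<in> finite_rank_ops \<Longrightarrow> bounded_clinear a"
  by (simp add: finite_rank_ops_def)


section \<open>Orthonormal bases of finitely generated subspaces\<close>

lemma orthonormal_inj: "orthonormal n e \<Longrightarrow> inj_on e {..<n}"
  unfolding orthonormal_def by (rule inj_onI) (metis lessThan_iff zero_neq_one)

lemma orthonormal_independent:
  assumes "orthonormal n e" "I \<subseteq> {..<n}"
  shows "\<not> complex_vector.dependent (e ` I)"
proof (rule complex_vector.independent_mono)
  show "e ` I \<subseteq> e ` {..<n}" using assms by auto
  show "\<not> complex_vector.dependent (e ` {..<n})"
  proof (rule complex_vector.independent_if_scalars_zero)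
    fix f x assume "(\<Sum>x\<in>e ` {..<n}. f x *\<^sub>C x) = 0" "x \<in> e ` {..<n}"
    then obtain j where j: "j < n" "x = e j" "(\<Sum>i<n. f (e i) *\<^sub>C e i) = 0"
      using orthonormal_inj[OF assms(1)] by (auto simp: sum.reindex)
    show "f x = 0" using orthonormal_cinner_sum[OF assms(1) j(1), of "\<lambda>i. f (e i)"] j by simp
  qed simp
qed

text \<open>This bound lets orthonormal families of maximal length be chosen inside a finitely
  generated subspace.\<close>

lemma orthonormal_le_card:
  assumes "orthonormal n e" "finite B" "\<And>i. i < n \<Longrightarrow> e i \<in> cspan B"
  shows "n \<le> card B"
  using complex_vector.independent_span_bound[OF assms(2) orthonormal_independent[OF assms(1) order.refl]]
    assms(3) orthonormal_inj[OF assms(1)] by (auto simp: card_image image_subset_iff)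

lemma orthonormal_extend:
  assumes "orthonormal n e" "norm u = 1" "\<And>i. i < n \<Longrightarrow> cinner (e i) u = 0"
  shows "orthonormal (Suc n) (e(n := u))"
  using assms cinner_commute[of u "e _"] by (auto simp: orthonormal_def less_Suc_eq cinner_self)

text \<open>One Gram-Schmidt step: the residual is nonzero and orthogonal to the family.\<close>

lemma orthonormal_extend_residual:
  assumes "orthonormal n e" "proj_op n e y \<noteq> y"
  obtains c where "orthonormal (Suc n) (e(n := c *\<^sub>C (y - proj_op n e y)))"
proof
  define z where "z = y - proj_op n e y"
  have "cinner (e i) z = 0" if "i < n" for i
    using cinner_diag_op[OF assms(1) that, of "\<lambda>_. 1" y] by (simp add: z_def cinner_diff_right)
  then show "orthonormal (Suc n) (e(n := complex_of_real (1 / norm z) *\<^sub>C (y - proj_op n e y)))"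
    unfolding z_def[symmetric] using assms
    by (intro orthonormal_extend) (auto simp: cinner_scaleC_right norm_scaleC norm_divide z_def)
qed

lemma diag_op_in_span:
  "(\<And>i. i < n \<Longrightarrow> e i \<in> cspan B) \<Longrightarrow> diag_op n e s x \<in> cspan B"
  by (auto simp: diag_op_def intro!: complex_vector.span_sum complex_vector.span_scale)

text \<open>Take an orthonormal family of maximal length in the span. A vector moved by the
  projection would extend it by its normalised residual.\<close>

lemma orthonormal_basis_exists:
  assumes "finite B"
  obtains n e where "orthonormal n e" "\<And>i. i < n \<Longrightarrow> e i \<in> cspan B"
    "\<And>x. x \<in> cspan B \<Longrightarrow> proj_op n e x = x"
proof -
  define Q where "Q n \<longleftrightarrow> (\<exists>e. orthonormal n e \<and> (\<forall>i<n. e i \<in> cspan B))" for n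
  have "Q 0" by (simp add: Q_def orthonormal_def)
  moreover have bound: "n \<le> card B" if "Q n" for n
    using that assms orthonormal_le_card unfolding Q_def by blast
  ultimately obtain n where "Q n" and max: "\<And>m. Q m \<Longrightarrow> m \<le> n"
    using GreatestI_nat[of Q 0 "card B"] Greatest_le_nat[of Q _ "card B"] by blast
  then obtain e where e: "orthonormal n e" "\<And>i. i < n \<Longrightarrow> e i \<in> cspan B"
    unfolding Q_def by auto
  have "proj_op n e x = x" if x: "x \<in> cspan B" for x
  proof (rule ccontr)
    assume "proj_op n e x \<noteq> x"
    then obtain c where "orthonormal (Suc n) (e(n := c *\<^sub>C (x - proj_op n e x)))"
      using orthonormal_extend_residual[OF e(1)] by metis
    then have "Q (Suc n)"
      unfolding Q_def using e x
      by (intro exI[of _ "e(n := c *\<^sub>C (x - proj_op n e x))"])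
         (auto simp: less_Suc_eq intro!: complex_vector.span_scale complex_vector.span_diff
           diag_op_in_span)
    with max[of "Suc n"] show False by simp
  qed
  with that e show ?thesis by blast
qed

text \<open>Gram-Schmidt never stops, because no finite family spans the space.\<close>

lemma orthonormal_exists:
  assumes "\<not> (\<exists>B :: 'h::complex_hilbert set. finite B \<and> cspan B = UNIV)"
  shows "\<exists>e :: nat \<Rightarrow> 'h. orthonormal n e"
proof (induction n)
  case 0
  show ?case by (simp add: orthonormal_def)
next
  case (Suc n)
  then obtain e :: "nat \<Rightarrow> 'h" where e: "orthonormal n e" by auto
  have "cspan (e ` {..<n}) \<noteq> UNIV" using assms by blast
  then obtain y where "y \<notin> cspan (e ` {..<n})" by auto
  then have "proj_op n e y \<noteq> y"
    using diag_op_in_span[of n e "e ` {..<n}" "\<lambda>_. 1" y]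
    by (metis complex_vector.span_base imageI lessThan_iff)
  then show ?case using orthonormal_extend_residual[OF e] by metis
qed

lemma compact_sphere_span:
  assumes "finite (B::'a::complex_hilbert set)"
  shows "compact {x \<in> cspan B. norm x = 1}"
proof -
  obtain n and e :: "nat \<Rightarrow> 'a" where e: "orthonormal n e" "\<And>i. i < n \<Longrightarrow> e i \<in> cspan B"
    "\<And>x. x \<in> cspan B \<Longrightarrow> proj_op n e x = x"
    using orthonormal_basis_exists[OF assms] by blast
  \<comment> \<open>Combinations with coefficients in the closed unit disc. Each further coordinate
    adds a compact disc, so compactness follows by induction, and Cauchy-Schwarz puts the unit
    sphere of the span inside \<open>C n\<close>.\<close>
  define C where "C m = {(\<Sum>i<m. c i *\<^sub>C e i) |c. \<forall>i<m. cmod (c i) \<le> 1}" for m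
  have "compact (C m)" for m
  proof (induction m)
    case 0
    show ?case by (simp add: C_def)
  next
    case (Suc m)
    have "C (Suc m) = {x + y |x y. x \<in> C m \<and> y \<in> (\<lambda>c. c *\<^sub>C e m) ` cball 0 1}" (is "_ = ?R")
    proof
      show "C (Suc m) \<subseteq> ?R" by (fastforce simp: C_def)
      show "?R \<subseteq> C (Suc m)"
      proof
        fix z assume "z \<in> ?R"
        then obtain c d where "z = (\<Sum>i<m. c i *\<^sub>C e i) + d *\<^sub>C e m" "\<forall>i<m. cmod (c i) \<le> 1" "cmod d \<le> 1"
          by (auto simp: C_def)
        then show "z \<in> C (Suc m)"
          by (auto simp: C_def less_Suc_eq intro!: exI[of _ "c(m := d)"])
      qed
    qed
    moreover have "compact ((\<lambda>c. c *\<^sub>C e m) ` cball 0 1)"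
      by (intro compact_continuous_image linear_continuous_on bounded_linear_scaleC_left compact_cball)
    ultimately show ?case using Suc by (simp add: compact_sums)
  qed
  moreover have "{x \<in> cspan B. norm x = 1} = C n \<inter> sphere 0 1"
  proof (intro equalityI subsetI)
    fix x assume "x \<in> {x \<in> cspan B. norm x = 1}"
    then have x: "x \<in> cspan B" "norm x = 1" by auto
    have "cmod (cinner (e i) x) \<le> 1" if "i < n" for i
      using cinner_cauchy_schwarz[of "e i" x] that x e(1) Re_cinner_self[of "e i"]
      by (auto simp: orthonormal_def power2_eq_1_iff)
    moreover have "x = (\<Sum>i<n. cinner (e i) x *\<^sub>C e i)"
      using e(3)[OF x(1)] by (simp add: diag_op_def)
    ultimately show "x \<in> C n \<inter> sphere 0 1" using x by (auto simp: C_def)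
  next
    fix x assume "x \<in> C n \<inter> sphere 0 1"
    then show "x \<in> {x \<in> cspan B. norm x = 1}"
      using e(2) by (auto simp: C_def intro!: complex_vector.span_sum complex_vector.span_scale)
  qed
  moreover have closed: "closed (sphere (0::'a) 1)"
    unfolding sphere_def by (intro closed_Collect_eq continuous_intros)
  ultimately show ?thesis using compact_Int_closed[of "C n" "sphere 0 1"] closed by simp
qed



section \<open>The spectral theorem for positive finite rank operators\<close>

text \<open>The polynomial has its minimum at t = 0, so its derivative \<open>2 * A\<close> there
  must vanish.\<close>

lemma linear_coefficient_zero:
  fixes A c :: real
  assumes "\<And>t. 0 \<le> 2 * t * A + t\<^sup>2 * c"
  shows "A = 0"
proof (rule ccontr)
  assume "A \<noteq> 0"
  \<comment> \<open>A positive upper bound of \<open>c\<close>, whatever the sign of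
    \<open>c\<close>; the point t = -A/d then gives a negative value.\<close>
  define d where "d = \<bar>c\<bar> + 1"
  have "d > 0" "c \<le> d" by (auto simp: d_def)
  have "(- A / d)\<^sup>2 * c \<le> (- A / d)\<^sup>2 * d"
    using \<open>c \<le> d\<close> by (intro mult_left_mono) auto
  also have "\<dots> = A\<^sup>2 / d" using \<open>d > 0\<close> by (simp add: power2_eq_square field_simps)
  finally have "0 \<le> - (A\<^sup>2 / d)"
    using assms[of "- A / d"] by (simp add: power2_eq_square)
  moreover have "0 < A\<^sup>2 / d" using \<open>A \<noteq> 0\<close> \<open>d > 0\<close> by simp
  ultimately show False by simp
qed

text \<open>This is the equality case of the Cauchy--Schwarz inequality for the semidefinite form
  \<open>\<langle>x, h y\<rangle>\<close>.\<close>

lemma semidefinite_kernel: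
  assumes h: "bounded_clinear h" and sym: "\<And>x y. cinner (h x) y = cinner x (h y)"
    and pos: "\<And>t::real. 0 \<le> Re (cinner (e + t *\<^sub>R h e) (h (e + t *\<^sub>R h e)))"
    and null: "Re (cinner e (h e)) = 0"
  shows "h e = (0::'a::complex_hilbert)"
proof -
  have "(norm (h e))\<^sup>2 = 0"
  proof (rule linear_coefficient_zero)
    fix t :: real
    have "Re (cinner (e + t *\<^sub>R h e) (h (e + t *\<^sub>R h e)))
        = 2 * t * (norm (h e))\<^sup>2 + t\<^sup>2 * Re (cinner (h e) (h (h e)))"
      using null sym[of e "h e"] Re_cinner_self[of "h e"]
      by (simp add: bounded_clinear_simps[OF h] cinner_linear scaleR_scaleC
          algebra_simps power2_eq_square)
    with pos[of t] show "0 \<le> 2 * t * (norm (h e))\<^sup>2 + t\<^sup>2 * Re (cinner (h e) (h (h e)))" by simp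
  qed
  then show ?thesis by simp
qed

text \<open>The quadratic form of \<open>b\<close> attains its maximum on the compact unit sphere of
  \<open>cspan B\<close>. At a maximiser \<open>u\<close> the form of \<open>h = q u - b\<close> is
  semidefinite on the span and zero at \<open>u\<close>, so \<open>u\<close> lies in the kernel of
  \<open>h\<close>.\<close>

lemma positive_eigenvector_exists:
  fixes b :: "'a::complex_hilbert \<Rightarrow> 'a"
  assumes b: "bounded_clinear b" and sym: "\<And>x y. cinner (b x) y = cinner x (b y)"
    and pos: "\<And>x. 0 \<le> Re (cinner x (b x))"
    and B: "finite B" "range b \<subseteq> cspan B" and y: "b y \<noteq> 0"
  obtains \<kappa> u where "\<kappa> > 0" "norm u = 1" "b u = \<kappa> *\<^sub>R u"
proof -
  define q where "q x = Re (cinner x (b x))" for x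
  have "continuous_on {x \<in> cspan B. norm x = 1} q"
    unfolding q_def using b
    by (intro continuous_on_Re bounded_bilinear.continuous_on[OF bounded_bilinear_cinner]
        continuous_on_id linear_continuous_on) (simp add: bounded_clinear_def)
  \<comment> \<open>The sphere is nonempty.\<close>
  moreover have "(1 / norm (b y)) *\<^sub>R b y \<in> {x \<in> cspan B. norm x = 1}"
    using y B(2) by (auto simp: scaleR_scaleC norm_scaleC norm_divide intro!: complex_vector.span_scale)
  ultimately obtain u where u: "u \<in> cspan B" "norm u = 1"
    and max: "\<And>x. x \<in> cspan B \<Longrightarrow> norm x = 1 \<Longrightarrow> q x \<le> q u"
    using continuous_attains_sup[OF compact_sphere_span[OF B(1)]] by blast
  have q_scale: "q (r *\<^sub>R x) = r\<^sup>2 * q x" for r x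
    by (simp add: q_def bounded_clinear_simps[OF b] scaleR_scaleC cinner_linear power2_eq_square)
  have q_le: "q x \<le> q u * (norm x)\<^sup>2" if "x \<in> cspan B" for x
  proof (cases "x = 0")
    case False
    then have "q ((1 / norm x) *\<^sub>R x) \<le> q u"
      using that by (intro max) (auto simp: scaleR_scaleC norm_scaleC norm_divide
          intro!: complex_vector.span_scale)
    with False show ?thesis by (simp add: q_scale power_divide divide_le_eq)
  qed (simp add: q_def)
  define h where "h x = q u *\<^sub>R x - b x" for x
  have h: "bounded_clinear h"
    unfolding h_def by (intro bounded_clinear_diff bounded_clinear_scaleR b)
  have h_sym: "cinner (h x) z = cinner x (h z)" for x z
    by (simp add: h_def cinner_linear scaleR_scaleC sym)
  have h_form: "Re (cinner x (h x)) = q u * (norm x)\<^sup>2 - q x" for x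
    by (simp add: h_def cinner_linear scaleR_scaleC Re_cinner_self q_def)
  have h_span: "h u \<in> cspan B"
    using u(1) B(2) by (auto simp: h_def scaleR_scaleC intro!: complex_vector.span_diff complex_vector.span_scale)
  have "h u = 0"
  proof (rule semidefinite_kernel[OF h h_sym])
    show "Re (cinner u (h u)) = 0" by (simp add: h_form u)
    \<comment> \<open>Semidefiniteness is known on \<open>cspan B\<close> only, which contains this
      whole line since \<open>u\<close> and \<open>h u\<close> lie in it.\<close>
    show "0 \<le> Re (cinner (u + t *\<^sub>R h u) (h (u + t *\<^sub>R h u)))" for t
      unfolding h_form using q_le[of "u + t *\<^sub>R h u"] u(1) h_span
      by (simp add: scaleR_scaleC complex_vector.span_add complex_vector.span_scale)
  qed
  then have "b u = q u *\<^sub>R u" by (simp add: h_def)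
  \<comment> \<open>Otherwise the form of \<open>b\<close> vanishes on the span, in particular at
    \<open>b y\<close>. The kernel argument then gives \<open>b (b y) = 0\<close>, and symmetry
    turns this into \<open>b y = 0\<close>.\<close>
  moreover have "q u > 0"
  proof (rule ccontr)
    assume "\<not> q u > 0"
    then have "q u * (norm x)\<^sup>2 \<le> 0" for x :: 'a by (simp add: mult_nonpos_nonneg)
    then have null: "q x = 0" if "x \<in> cspan B" for x
      using q_le[OF that] pos[of x] by (metis q_def order.antisym order.trans)
    have "b (b y) = 0"
    proof (rule semidefinite_kernel[OF b sym])
      show "0 \<le> Re (cinner (b y + t *\<^sub>R b (b y)) (b (b y + t *\<^sub>R b (b y))))" for t by (rule pos)
      show "Re (cinner (b y) (b (b y))) = 0" using null[of "b y"] B(2) by (auto simp: q_def)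
    qed
    then have "(norm (b y))\<^sup>2 = 0" using sym[of y "b y"] by (simp flip: Re_cinner_self)
    with y show False by simp
  qed
  ultimately show ?thesis using that u(2) by blast
qed

text \<open>Take a maximal orthonormal family of eigenvectors with positive eigenvalues; its length
  is bounded because such eigenvectors lie in the range of \<open>b\<close>. If the remainder
  \<open>b'\<close> were nonzero, it would have a positive eigenvector too, which extends the
  family.\<close>

lemma spectral_theorem:
  fixes b :: "'a::complex_hilbert \<Rightarrow> 'a"
  assumes b: "bounded_clinear b" and sym: "\<And>x y. cinner (b x) y = cinner x (b y)"
    and pos: "\<And>x. 0 \<le> Re (cinner x (b x))"
    and B: "finite B" "range b \<subseteq> cspan B"
  obtains n e \<kappa> where "orthonormal n e" "\<And>i. i < n \<Longrightarrow> 0 < \<kappa> i" "b = diag_op n e \<kappa>"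
proof -
  define Q where "Q n \<longleftrightarrow> (\<exists>e \<kappa>. orthonormal n e \<and> (\<forall>i<n. 0 < \<kappa> i \<and> b (e i) = \<kappa> i *\<^sub>R e i))" for n
  have eig_span: "x \<in> cspan B" if "b x = r *\<^sub>R x" "0 < r" for x and r :: real
  proof -
    have "x = (1 / r) *\<^sub>R b x" using that by simp
    moreover have "(1 / r) *\<^sub>R b x \<in> cspan B"
      using B(2) by (auto simp: scaleR_scaleC intro!: complex_vector.span_scale)
    ultimately show ?thesis by simp
  qed
  have "Q 0" by (simp add: Q_def orthonormal_def)
  moreover have "n \<le> card B" if "Q n" for n
    using that orthonormal_le_card[OF _ B(1)] eig_span unfolding Q_def by blast
  ultimately obtain n where "Q n" and max: "\<And>m. Q m \<Longrightarrow> m \<le> n"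
    using GreatestI_nat[of Q 0 "card B"] Greatest_le_nat[of Q _ "card B"] by blast
  then obtain e \<kappa> where e: "orthonormal n e" and \<kappa>: "\<And>i. i < n \<Longrightarrow> 0 < \<kappa> i"
    and eig: "\<And>i. i < n \<Longrightarrow> b (e i) = \<kappa> i *\<^sub>R e i"
    using \<open>Q n\<close> unfolding Q_def by blast
  define b' where "b' x = b x - diag_op n e \<kappa> x" for x
  have b': "bounded_clinear b'"
    unfolding b'_def by (intro bounded_clinear_diff bounded_clinear_diag_op b)
  have b'_proj: "b' x = b (x - proj_op n e x)" for x
    by (simp add: b'_def diag_op_def bounded_clinear_simps[OF b] eig scaleR_scaleC scaleC_scaleC mult.commute)
  have b'_sym: "cinner (b' x) z = cinner x (b' z)" for x z
    by (simp add: b'_def cinner_linear sym diag_op_selfadjoint)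
  have b'_orth: "cinner (e i) (b' x) = 0" if "i < n" for i x
    using sym[of "e i" x] eig[OF that] cinner_diag_op[OF e that, of \<kappa> x]
    by (simp add: b'_def cinner_linear scaleR_scaleC)
  have "b' = (\<lambda>_. 0)"
  proof (rule ccontr)
    assume "b' \<noteq> (\<lambda>_. 0)"
    then obtain y where "b' y \<noteq> 0" by auto
    moreover have "0 \<le> Re (cinner x (b' x))" for x
    proof -
      \<comment> \<open>Since \<open>b'\<close> maps into the complement of the family, its form at
        \<open>x\<close> equals the form of \<open>b\<close> at the residual of
        \<open>x\<close>.\<close>
      have "cinner (proj_op n e x) (b' x) = 0"
        unfolding diag_op_def cinner_linear using b'_orth by simp
      then have "cinner x (b' x) = cinner (x - proj_op n e x) (b (x - proj_op n e x))"
        by (simp add: cinner_diff_left b'_proj)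
      then show ?thesis using pos by simp
    qed
    moreover have "range b' \<subseteq> cspan B"
      using B(2) eig_span[OF eig \<kappa>]
      by (auto simp: b'_def intro!: complex_vector.span_diff diag_op_in_span)
    ultimately obtain r u where u: "r > 0" "norm u = 1" "b' u = r *\<^sub>R u"
      using positive_eigenvector_exists[OF b' b'_sym _ B(1)] by blast
    \<comment> \<open>\<open>u\<close> is a multiple of \<open>b' u\<close>, hence orthogonal to the
      family; there \<open>b'\<close> and \<open>b\<close> agree.\<close>
    have orth: "cinner (e i) u = 0" if "i < n" for i
      using b'_orth[OF that, of u] u by (simp add: scaleR_scaleC cinner_linear)
    then have "b u = r *\<^sub>R u" using u by (simp add: b'_def diag_op_def)
    then have "Q (Suc n)"
      unfolding Q_def using orthonormal_extend[OF e u(2) orth] u \<kappa> eig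
      by (intro exI[of _ "e(n := u)"] exI[of _ "\<kappa>(n := r)"]) (auto simp: less_Suc_eq)
    with max[of "Suc n"] show False by simp
  qed
  then have "b = diag_op n e \<kappa>" by (auto simp: b'_def fun_eq_iff)
  with that e \<kappa> show ?thesis by blast
qed

lemma spectral_theorem_sorted:
  fixes b :: "'a::complex_hilbert \<Rightarrow> 'a"
  assumes "bounded_clinear b" "\<And>x y. cinner (b x) y = cinner x (b y)"
    "\<And>x. 0 \<le> Re (cinner x (b x))" "finite B" "range b \<subseteq> cspan B"
  obtains n e s where "orthonormal n e" "antimono s" "\<And>i. 0 \<le> s i" "\<And>i. n \<le> i \<Longrightarrow> s i = 0"
    "b = diag_op n e s"
proof -
  obtain n and e :: "nat \<Rightarrow> 'a" and \<kappa> where e: "orthonormal n e"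
    and \<kappa>: "\<And>i. i < n \<Longrightarrow> 0 < \<kappa> i" and b: "b = diag_op n e \<kappa>"
    using spectral_theorem[OF assms] by blast
  \<comment> \<open>The negated key sorts the indices by decreasing eigenvalue.\<close>
  define xs where "xs = sort_key (\<lambda>i. - \<kappa> i) [0..<n]"
  have xs: "length xs = n" "distinct xs" "set xs = {..<n}"
    by (auto simp: xs_def)
  have nth: "xs ! i < n" if "i < n" for i
    using nth_mem[of i xs] xs that by simp
  have bij: "bij_betw ((!) xs) {..<n} {..<n}"
    by (rule bij_betw_nth) (simp_all add: xs)
  define s where "s i = (if i < n then \<kappa> (xs ! i) else 0)" for i
  show ?thesis
  proof
    show "orthonormal n (\<lambda>i. e (xs ! i))"
      using e xs nth by (auto simp: orthonormal_def nth_eq_iff_index_eq)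
    have "sorted (map (\<lambda>i. - \<kappa> i) xs)" by (simp add: xs_def)
    then have "\<kappa> (xs ! j) \<le> \<kappa> (xs ! i)" if "i \<le> j" "j < n" for i j
      using that xs by (auto simp: sorted_iff_nth_mono)
    then show "antimono s"
      using \<kappa>[OF nth] by (auto simp: s_def antimono_def intro: less_imp_le)
    show "0 \<le> s i" for i using \<kappa>[OF nth] by (auto simp: s_def intro: less_imp_le)
    show "b = diag_op n (\<lambda>i. e (xs ! i)) s"
      unfolding b diag_op_def fun_eq_iff s_def
      by (subst sum.reindex_bij_betw[OF bij, symmetric]) simp
  qed (simp add: s_def)
qed


section \<open>Adjoints\<close>

lemma riesz_representation:
  fixes f :: "'a::complex_hilbert \<Rightarrow> complex"
  assumes "bounded_linear f" and f_scaleC: "\<And>c x. f (c *\<^sub>C x) = c * f x"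
  obtains w where "\<And>x. f x = cinner w x"
proof -
  interpret bounded_linear f by fact
  obtain K where K: "\<And>x. cmod (f x) \<le> norm x * K" using bounded by blast
  \<comment> \<open>The representing vector minimises \<open>J\<close>; minimising sequences are Cauchy by the
    parallelogram law.\<close>
  define J where "J x = (norm x)\<^sup>2 - 2 * Re (f x)" for x
  have J_lower: "- K\<^sup>2 \<le> J x" for x
  proof -
    have "Re (f x) \<le> norm x * K" using K[of x] abs_Re_le_cmod[of "f x"] by simp
    moreover have "0 \<le> (norm x - K)\<^sup>2" by simp
    ultimately show ?thesis by (simp add: J_def power2_eq_square algebra_simps)
  qed
  define m where "m = (INF x. J x)"
  have bdd: "bdd_below (range J)" using J_lower by (auto simp: bdd_below_def)
  then have m_le: "m \<le> J x" for x unfolding m_def by (rule cINF_lower) simp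
  have "\<exists>x. J x < m + 1 / Suc k" for k
    using cINF_less_iff[OF _ bdd, of "m + 1 / Suc k"] by (simp add: m_def)
  then obtain X where X: "\<And>k. J (X k) < m + 1 / Suc k" by metis
  have dist_le: "(norm (x - y))\<^sup>2 \<le> 2 * J x + 2 * J y - 4 * m" for x y
  proof -
    have "4 * J ((1/2) *\<^sub>R (x + y)) = (norm (x + y))\<^sup>2 - 4 * Re (f x) - 4 * Re (f y)"
      by (simp add: J_def scaleR add power_mult_distrib power_divide) (simp add: field_simps)
    then have "(norm (x - y))\<^sup>2 = 2 * J x + 2 * J y - 4 * J ((1/2) *\<^sub>R (x + y))"
      by (simp add: J_def[of x] J_def[of y] norm_add_sq norm_diff_sq)
    with m_le[of "(1/2) *\<^sub>R (x + y)"] show ?thesis by simp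
  qed
  have "Cauchy X"
  proof (rule CauchyI)
    fix r :: real assume "0 < r"
    then obtain N where N: "1 / Suc N < r\<^sup>2 / 4"
      using reals_Archimedean[of "r\<^sup>2 / 4"] unfolding inverse_eq_divide by fastforce
    have near: "J (X i) < m + r\<^sup>2 / 4" if "N \<le> i" for i
    proof -
      have "J (X i) < m + 1 / Suc i" by (rule X)
      also have "\<dots> \<le> m + 1 / Suc N" using that by (simp add: frac_le)
      also have "\<dots> < m + r\<^sup>2 / 4" using N by simp
      finally show ?thesis .
    qed
    have "norm (X i - X j) < r" if "N \<le> i" "N \<le> j" for i j
    proof -
      have "(norm (X i - X j))\<^sup>2 < r\<^sup>2" using dist_le[of "X i" "X j"] near[OF that(1)] near[OF that(2)] by linarith
      then show ?thesis using \<open>0 < r\<close> by (simp add: power_less_imp_less_base)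
    qed
    then show "\<exists>N. \<forall>i\<ge>N. \<forall>j\<ge>N. norm (X i - X j) < r" by blast
  qed
  then obtain w where w: "X \<longlonglongrightarrow> w" using Cauchy_convergent convergent_def by blast
  have "(\<lambda>k. J (X k)) \<longlonglongrightarrow> J w" unfolding J_def by (intro tendsto_intros w tendsto)
  moreover have "(\<lambda>k. m + 1 / Suc k) \<longlonglongrightarrow> m + 0"
    by (intro tendsto_intros LIMSEQ_Suc[OF lim_1_over_n])
  ultimately have "J w \<le> m"
    using LIMSEQ_le[of "\<lambda>k. J (X k)" "J w" "\<lambda>k. m + 1 / Suc k" "m + 0"] X by (auto intro: less_imp_le)
  \<comment> \<open>First variation: \<open>J\<close> is minimal at \<open>w\<close> along every
    line through \<open>w\<close>.\<close>
  have Re_eq: "Re (f y) = Re (cinner w y)" for y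
  proof -
    have "Re (cinner w y) - Re (f y) = 0"
    proof (rule linear_coefficient_zero)
      fix t :: real
      have "J w \<le> J (w + t *\<^sub>R y)" using \<open>J w \<le> m\<close> m_le order.trans by blast
      then show "0 \<le> 2 * t * (Re (cinner w y) - Re (f y)) + t\<^sup>2 * (norm y)\<^sup>2"
        by (simp add: J_def norm_add_sq scaleR add scaleR_scaleC cinner_linear norm_scaleC
            power_mult_distrib f_scaleC algebra_simps)
    qed
    then show ?thesis by simp
  qed
  have "f y = cinner w y" for y
  proof (rule complex_eqI)
    \<comment> \<open>A complex linear functional is determined by its real part, evaluated here at
      \<open>\<i> *\<^sub>C y\<close>.\<close>
    show "Im (f y) = Im (cinner w y)"
      using Re_eq[of "\<i> *\<^sub>C y"] by (simp add: f_scaleC cinner_linear)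
  qed (rule Re_eq)
  with that show ?thesis by blast
qed

text \<open>In an orthonormal basis of a finitely generated space containing the range, each
  coordinate of \<open>a x\<close> is a bounded functional of \<open>x\<close>. Its representing
  vector \<open>w i\<close> is the image of \<open>e i\<close> under the adjoint.\<close>

lemma finite_rank_adjoint_exists:
  assumes "a \<in> finite_rank_ops"
  obtains b where "b \<in> finite_rank_ops" "\<And>x y. cinner (a x) y = cinner x (b y)"
proof -
  from assms obtain B where B: "finite B" "range a \<subseteq> cspan B" and a: "bounded_clinear a"
    by (auto simp: finite_rank_ops_def)
  obtain n and e :: "nat \<Rightarrow> 'a" where e: "orthonormal n e" "\<And>x. x \<in> cspan B \<Longrightarrow> proj_op n e x = x"
    using orthonormal_basis_exists[OF B(1)] by metis
  have "\<exists>w. \<forall>x. cinner (e i) (a x) = cinner w x" for i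
  proof -
    have "bounded_linear (\<lambda>x. cinner (e i) (a x))"
      using a by (auto simp: bounded_clinear_def
          intro: bounded_linear_compose[OF bounded_bilinear.bounded_linear_right[OF bounded_bilinear_cinner]])
    then obtain w where "\<And>x. cinner (e i) (a x) = cinner w x"
      using riesz_representation[of "\<lambda>x. cinner (e i) (a x)"]
      by (auto simp: bounded_clinear_simps[OF a] cinner_linear)
    then show ?thesis by blast
  qed
  then obtain w where w: "\<And>i x. cinner (e i) (a x) = cinner (w i) x" by metis
  define b where "b y = (\<Sum>i<n. (1 * cinner (e i) y) *\<^sub>C w i)" for y
  have "b \<in> finite_rank_ops"
    unfolding finite_rank_ops_def b_def
    using bounded_clinear_sum_cinner[of "\<lambda>_. 1" e w "{..<n}"]
    by (auto intro!: exI[of _ "w ` {..<n}"]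
        complex_vector.span_sum complex_vector.span_scale intro: complex_vector.span_base)
  moreover have "cinner (a x) y = cinner x (b y)" for x y
  proof -
    have "a x = (\<Sum>i<n. cinner (w i) x *\<^sub>C e i)"
      using e(2)[of "a x"] B(2) by (simp add: diag_op_def w image_subset_iff)
    then show ?thesis
      by (simp add: b_def cinner_linear cinner_commute[of "w _" x] mult.commute)
  qed
  ultimately show ?thesis using that by blast
qed

lemma cadjoint_finite_rank:
  assumes "a \<in> finite_rank_ops"
  shows "cadjoint a \<in> finite_rank_ops" "cinner (a x) y = cinner x (cadjoint a y)"
proof -
  obtain b where b: "b \<in> finite_rank_ops" "\<And>x y. cinner (a x) y = cinner x (b y)"
    using finite_rank_adjoint_exists[OF assms] by blast
  have "cadjoint a = b"
    unfolding cadjoint_def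
  proof (rule the_equality)
    show "bounded_clinear b \<and> (\<forall>x y. cinner (a x) y = cinner x (b y))"
      using b by (auto simp: finite_rank_ops_def)
    fix c assume "bounded_clinear c \<and> (\<forall>x y. cinner (a x) y = cinner x (c y))"
    then have "cinner x (c y) = cinner x (b y)" for x y using b(2) by metis
    then show "c = b" by (intro ext cinner_ext)
  qed
  with b show "cadjoint a \<in> finite_rank_ops" "cinner (a x) y = cinner x (cadjoint a y)" by auto
qed


section \<open>Functional calculus and eigenvalue lists of diagonal operators\<close>

lemma diag_op_on_basis:
  assumes "orthonormal n e" "i < n"
  shows "diag_op n e s (e i) = s i *\<^sub>R e i"
proof -
  have "diag_op n e s (e i) = (\<Sum>j<n. if j = i then complex_of_real (s i) *\<^sub>C e i else 0)"
    unfolding diag_op_def using assms by (intro sum.cong) (auto simp: orthonormal_def)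
  then show ?thesis using assms by (simp add: scaleR_scaleC)
qed

lemma diag_op_eigenvector:
  assumes "orthonormal n e" "diag_op n e s x = \<mu> *\<^sub>R x" "i < n" "cinner (e i) x \<noteq> 0"
  shows "s i = \<mu>"
  using cinner_diag_op[OF assms(1,3), of s x] assms by (simp add: scaleR_scaleC cinner_linear)

text \<open>The condition \<open>f 0 = 0\<close> is what makes the result a finite sum again: on the
  complement of the family the calculus multiplies by \<open>f 0\<close>.\<close>

lemma fun_calc_diag_op:
  assumes e: "orthonormal n e" and f: "f 0 = 0"
  shows "fun_calc f (diag_op n e s) = diag_op n e (\<lambda>i. f (s i))"
  unfolding fun_calc_def
proof (rule the_equality, intro conjI allI impI)
  show "bounded_clinear (diag_op n e (\<lambda>i. f (s i)))" by (rule bounded_clinear_diag_op)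
  fix \<mu> x assume eig: "diag_op n e s x = \<mu> *\<^sub>R x"
  have "diag_op n e (\<lambda>i. f (s i)) x = f \<mu> *\<^sub>R proj_op n e x"
    unfolding diag_op_def scaleR_sum_right
    by (intro sum.cong) (use diag_op_eigenvector[OF e eig] in \<open>force simp: scaleR_scaleC scaleC_scaleC\<close>)+
  \<comment> \<open>For nonzero \<open>\<mu>\<close> an eigenvector is fixed by the projection; for
    \<open>\<mu> = 0\<close> both sides vanish.\<close>
  also have "\<dots> = f \<mu> *\<^sub>R x"
  proof (cases "\<mu> = 0")
    case False
    have "x = (1 / \<mu>) *\<^sub>R diag_op n e s x" using False eig by simp
    also have "\<dots> = proj_op n e x"
      unfolding diag_op_def scaleR_sum_right using False
      by (intro sum.cong) (use diag_op_eigenvector[OF e eig] in \<open>force simp: scaleR_scaleC scaleC_scaleC\<close>)+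
    finally show ?thesis by simp
  qed (simp add: f)
  finally show "diag_op n e (\<lambda>i. f (s i)) x = f \<mu> *\<^sub>R x" .
next
  fix c assume "bounded_clinear c \<and> (\<forall>\<mu> x. diag_op n e s x = \<mu> *\<^sub>R x \<longrightarrow> c x = f \<mu> *\<^sub>R x)"
  then have c: "bounded_clinear c" and eig: "\<And>\<mu> x. diag_op n e s x = \<mu> *\<^sub>R x \<Longrightarrow> c x = f \<mu> *\<^sub>R x"
    by blast+
  show "c = diag_op n e (\<lambda>i. f (s i))"
  proof
    fix x
    \<comment> \<open>The residual lies in the kernel, so \<open>c\<close> kills it; what remains is
      fixed by the values of \<open>c\<close> on the basis.\<close>
    have "diag_op n e s (x - proj_op n e x) = 0 *\<^sub>R (x - proj_op n e x)"
      using cinner_diag_op[OF e, of _ "\<lambda>_. 1" x]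
      by (simp add: diag_op_def[of n e s] cinner_diff_right)
    then have "c (x - proj_op n e x) = 0" using eig f by (metis scaleR_zero_left)
    then have "c x = c (proj_op n e x)" by (simp add: bounded_clinear_simps[OF c])
    also have "\<dots> = (\<Sum>i<n. cinner (e i) x *\<^sub>C c (e i))"
      by (simp add: diag_op_def bounded_clinear_simps[OF c])
    also have "\<dots> = diag_op n e (\<lambda>i. f (s i)) x"
      unfolding diag_op_def
      by (intro sum.cong) (simp_all add: eig[OF diag_op_on_basis[OF e]] scaleR_scaleC scaleC_scaleC mult.commute)
    finally show "c x = diag_op n e (\<lambda>i. f (s i)) x" .
  qed
qed

lemma op_powr_diag_op:
  "orthonormal n e \<Longrightarrow> op_powr (diag_op n e s) p = diag_op n e (\<lambda>i. s i powr p)"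
  by (simp add: op_powr_def fun_calc_diag_op)

text \<open>Dividing by the nonzero \<open>\<mu>\<close> writes an eigenvector as a value of the
  operator, hence as a combination of the \<open>e i\<close>; only those with
  \<open>s i = \<mu>\<close> have a nonzero coefficient.\<close>

lemma cdim_eigenspace_diag_op:
  assumes e: "orthonormal n e" and "\<mu> \<noteq> 0"
  shows "cdim {x. diag_op n e s x = \<mu> *\<^sub>R x} = card {i. i < n \<and> s i = \<mu>}"
proof -
  let ?I = "{i. i < n \<and> s i = \<mu>}"
  have "{x. diag_op n e s x = \<mu> *\<^sub>R x} = cspan (e ` ?I)" (is "?E = _")
  proof
    show "?E \<subseteq> cspan (e ` ?I)"
    proof
      fix x assume "x \<in> ?E"
      then have eig: "diag_op n e s x = \<mu> *\<^sub>R x" by simp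
      have "x = (1 / \<mu>) *\<^sub>R diag_op n e s x" using \<open>\<mu> \<noteq> 0\<close> eig by simp
      also have "\<dots> \<in> cspan (e ` ?I)"
        unfolding diag_op_def scaleR_scaleC
      proof (rule complex_vector.span_scale, rule complex_vector.span_sum)
        fix i assume "i \<in> {..<n}"
        then show "(complex_of_real (s i) * cinner (e i) x) *\<^sub>C e i \<in> cspan (e ` ?I)"
          using diag_op_eigenvector[OF e eig]
          by (cases "cinner (e i) x = 0")
             (auto intro!: complex_vector.span_scale complex_vector.span_zero
               intro: complex_vector.span_base)
      qed
      finally show "x \<in> cspan (e ` ?I)" .
    qed
    have "csubspace ?E"
      by (rule complex_vector.subspaceI)
         (simp_all add: bounded_clinear_simps[OF bounded_clinear_diag_op] scaleR_scaleC
           scaleC_add_right scaleC_scaleC mult.commute)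
    then show "cspan (e ` ?I) \<subseteq> ?E"
      by (intro complex_vector.span_minimal) (auto simp: diag_op_on_basis[OF e])
  qed
  moreover have "cdim (cspan (e ` ?I)) = card (e ` ?I)"
    using orthonormal_independent[OF e, of ?I]
    by (intro complex_vector.dim_span_eq_card_independent) auto
  moreover have "card (e ` ?I) = card ?I"
    by (intro card_image inj_on_subset[OF orthonormal_inj[OF e]]) auto
  ultimately show ?thesis by simp
qed

section \<open>Uniqueness of eigenvalue lists\<close>

lemma finite_downset_eq_lessThan:
  fixes A :: "nat set"
  assumes "finite A" "\<And>i j. i \<in> A \<Longrightarrow> j \<le> i \<Longrightarrow> j \<in> A"
  shows "A = {..<card A}"
proof (cases "A = {}")
  case False
  have "A = {..Max A}" using assms(1) assms(2)[OF Max_in[OF assms(1) False]] by auto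
  then show ?thesis by (metis card_atMost lessThan_Suc_atMost)
qed simp

text \<open>The sets where the sequences are at least t > 0 are initial segments, so equal
  cardinality makes them equal, and these sets determine a nonnegative sequence. Multiplicities of
  zero are never consulted.\<close>

lemma antimono_eq_if_multiplicities_eq:
  fixes k l :: "nat \<Rightarrow> real"
  assumes mono: "antimono k" "antimono l" and nonneg: "\<And>i. 0 \<le> k i" "\<And>i. 0 \<le> l i"
    and zero: "\<And>i. n \<le> i \<Longrightarrow> l i = 0"
    and mult: "\<And>\<mu>. \<mu> > 0 \<Longrightarrow> finite {i. k i = \<mu>} \<and> card {i. k i = \<mu>} = card {i. l i = \<mu>}"
  shows "k = l"
proof -
  have less: "i < n" if "l i \<noteq> 0" for i using that zero not_le by blast
  have fin_l: "finite {i. l i = \<mu>}" if "\<mu> > 0" for \<mu>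
    by (rule finite_subset[of _ "{..<n}"]) (use that less in auto)
  have level: "{i. t \<le> k i} = {i. t \<le> l i}" if "t > 0" for t
  proof -
    \<comment> \<open>The finitely many values of \<open>l\<close> that are at least
      \<open>t\<close>. Values of \<open>k\<close> in this range belong to it as well, since they
      have positive multiplicity in \<open>k\<close> and hence in \<open>l\<close>.\<close>
    define M where "M = l ` {..<n} \<inter> {t..}"
    have lM: "l i \<in> M" if "t \<le> l i" for i
      using zero[of i] that \<open>t > 0\<close> by (cases "i < n") (auto simp: M_def)
    have kM: "k i \<in> M" if "t \<le> k i" for i
    proof -
      have pos: "k i > 0" using that \<open>t > 0\<close> by simp
      then have "0 < card {j. k j = k i}" unfolding card_gt_0_iff using mult by blast
      then have "{j. l j = k i} \<noteq> {}" using mult[OF pos] by (metis card.empty less_irrefl)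
      then obtain j where "l j = k i" by blast
      with lM[of j] that show ?thesis by simp
    qed
    have k_eq: "{i. t \<le> k i} = (\<Union>\<mu>\<in>M. {i. k i = \<mu>})" and l_eq: "{i. t \<le> l i} = (\<Union>\<mu>\<in>M. {i. l i = \<mu>})"
      using kM lM by (auto simp: M_def)
    have M: "finite M" "\<And>\<mu>. \<mu> \<in> M \<Longrightarrow> \<mu> > 0" using \<open>t > 0\<close> by (auto simp: M_def)
    have fin: "finite {i. t \<le> k i}" "finite {i. t \<le> l i}"
      unfolding k_eq l_eq using M mult fin_l by auto
    have "card {i. t \<le> k i} = (\<Sum>\<mu>\<in>M. card {i. k i = \<mu>})"
      unfolding k_eq using M mult by (intro card_UN_disjoint) auto
    also have "\<dots> = (\<Sum>\<mu>\<in>M. card {i. l i = \<mu>})" using M mult by (intro sum.cong) auto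
    also have "\<dots> = card {i. t \<le> l i}"
      unfolding l_eq using M fin_l by (intro card_UN_disjoint[symmetric]) auto
    finally have card_eq: "card {i. t \<le> k i} = card {i. t \<le> l i}" .
    have "{i. t \<le> k i} = {..<card {i. t \<le> k i}}"
      by (rule finite_downset_eq_lessThan[OF fin(1)]) (auto intro: order.trans antimonoD[OF mono(1)])
    moreover have "{i. t \<le> l i} = {..<card {i. t \<le> l i}}"
      by (rule finite_downset_eq_lessThan[OF fin(2)]) (auto intro: order.trans antimonoD[OF mono(2)])
    ultimately show ?thesis using card_eq by argo
  qed
  show ?thesis
  proof
    fix i
    have "k i \<le> l i" using level[of "k i"] nonneg[of i] by (cases "k i = 0") auto
    moreover have "l i \<le> k i" using level[of "l i"] nonneg[of i] by (cases "l i = 0") auto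
    ultimately show "k i = l i" by simp
  qed
qed

lemma eigenvalue_diag_op:
  assumes e: "orthonormal n e" and s: "antimono s" "\<And>i. 0 \<le> s i" "\<And>i. n \<le> i \<Longrightarrow> s i = 0"
  shows "eigenvalue (diag_op n e s) = s"
proof -
  have eq: "{i. s i = \<mu>} = {i. i < n \<and> s i = \<mu>}" if "\<mu> > 0" for \<mu>
    using s(3) that not_le by (metis (mono_tags, lifting) order.irrefl)
  then have list: "is_eigenvalue_list (diag_op n e s) s"
    unfolding is_eigenvalue_list_def using s by (auto simp: cdim_eigenspace_diag_op[OF e])
  have "l = s" if "is_eigenvalue_list (diag_op n e s) l" for l
    using that list s(3) unfolding is_eigenvalue_list_def
    by (intro antimono_eq_if_multiplicities_eq[of l s n]) auto
  with list show ?thesis unfolding eigenvalue_def by (rule the_equality)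
qed

text \<open>The bound \<open>N\<close> is left free so that operators with families of different
  lengths can share one.\<close>

lemma choquet_trace_diag_op:
  assumes e: "orthonormal n e" and s: "antimono s" "\<And>i. 0 \<le> s i" "\<And>i. n \<le> i \<Longrightarrow> s i = 0"
    and \<alpha>: "\<And>i. 0 \<le> \<alpha> i" and "n \<le> N"
  shows "choquet_trace \<alpha> (diag_op n e s) = ennreal (\<Sum>i<N. (s i - s (Suc i)) * \<alpha> (Suc i))"
proof -
  have "s (Suc i) \<le> s i" for i using s(1) by (simp add: antimonoD)
  then have "ennreal (\<Sum>i<N. (s i - s (Suc i)) * \<alpha> (Suc i))
      = (\<Sum>i<N. ennreal ((s i - s (Suc i)) * \<alpha> (Suc i)))"
    using \<alpha> by (intro sum_ennreal[symmetric]) simp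
  moreover have "eigenvalue (diag_op n e s) = s" by (intro eigenvalue_diag_op e s)
  then have "choquet_trace \<alpha> (diag_op n e s) = (\<Sum>i<N. ennreal ((s i - s (Suc i)) * \<alpha> (Suc i)))"
    unfolding choquet_trace_def using s(3) \<open>n \<le> N\<close>
    by (simp, intro suminf_finite) auto
  ultimately show ?thesis by simp
qed


section \<open>Singular values\<close>

text \<open>Only right singular vectors are recorded. The last clause states weakly, without an
  adjoint, that the squares \<open>(s i)\<^sup>2\<close> diagonalise the product of the adjoint with
  \<open>a\<close>.\<close>

definition is_svd :: "('a::complex_hilbert \<Rightarrow> 'a) \<Rightarrow> nat \<Rightarrow> (nat \<Rightarrow> 'a) \<Rightarrow> (nat \<Rightarrow> real) \<Rightarrow> bool" where
  "is_svd a n e s \<longleftrightarrow> orthonormal n e \<and> antimono s \<and> (\<forall>i. 0 \<le> s i) \<and> (\<forall>i\<ge>n. s i = 0) \<and>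
    (\<forall>x y. cinner (a x) (a y) = cinner x (diag_op n e (\<lambda>i. (s i)\<^sup>2) y))"

lemma is_svdD:
  assumes "is_svd a n e s"
  shows "orthonormal n e" "antimono s" "0 \<le> s i" "n \<le> i \<Longrightarrow> s i = 0"
    "cinner (a x) (a y) = cinner x (diag_op n e (\<lambda>i. (s i)\<^sup>2) y)"
  using assms by (auto simp: is_svd_def)

lemma svd_exists:
  assumes "a \<in> finite_rank_ops"
  obtains n e s where "is_svd a n e s"
proof -
  note adj = cadjoint_finite_rank[OF assms]
  have adj': "cinner (cadjoint a x) y = cinner x (a y)" for x y
    using adj(2)[of y x] by (metis cinner_commute)
  obtain B where B: "finite B" "range (cadjoint a) \<subseteq> cspan B"
    using adj(1) by (auto simp: finite_rank_ops_def)
  obtain n and e :: "nat \<Rightarrow> 'a" and s where *: "orthonormal n e" "antimono s" "\<And>i. 0 \<le> s i"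
    "\<And>i. n \<le> i \<Longrightarrow> s i = 0" and eq: "cadjoint a \<circ> a = diag_op n e s"
  proof (rule spectral_theorem_sorted[OF _ _ _ B(1)])
    show "bounded_clinear (cadjoint a \<circ> a)"
      using assms adj(1) by (intro bounded_clinear_compose finite_rank_opsD)
    show "cinner ((cadjoint a \<circ> a) x) y = cinner x ((cadjoint a \<circ> a) y)" for x y
      using adj adj' by simp
    show "0 \<le> Re (cinner x ((cadjoint a \<circ> a) x))" for x
      using adj(2)[of x "a x"] by (simp flip: adj(2) add: Re_cinner_self)
    show "range (cadjoint a \<circ> a) \<subseteq> cspan B" using B(2) by auto
  qed blast
  have "is_svd a n e (\<lambda>i. sqrt (s i))"
    unfolding is_svd_def using * adj(2) fun_cong[OF eq] by (auto simp: antimono_def)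
  with that show ?thesis by blast
qed

lemma op_abs_eq_diag_op:
  assumes "a \<in> finite_rank_ops" "is_svd a n e s"
  shows "op_abs a = diag_op n e s"
proof -
  have "cadjoint a \<circ> a = diag_op n e (\<lambda>i. (s i)\<^sup>2)"
    using cadjoint_finite_rank(2)[OF assms(1)] is_svdD(5)[OF assms(2)]
    by (intro ext cinner_ext) (metis comp_apply)
  moreover have "((s i)\<^sup>2) powr (1/2) = s i" for i
    using is_svdD(3)[OF assms(2)] by (simp add: powr_half_sqrt)
  ultimately show ?thesis
    by (simp add: op_abs_def op_powr_diag_op[OF is_svdD(1)[OF assms(2)]])
qed

text \<open>Makes condition (1), stated for the absolute value itself, the case p = 1 of the results
  on powers.\<close>

lemma op_powr_1_op_abs:
  assumes "a \<in> finite_rank_ops"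
  shows "op_powr (op_abs a) 1 = op_abs a"
proof -
  obtain n e s where svd: "is_svd a n e s" using svd_exists[OF assms] .
  show ?thesis
    using is_svdD(1,3)[OF svd]
    by (simp add: op_abs_eq_diag_op[OF assms svd] op_powr_diag_op)
qed

lemma choquet_trace_svd:
  assumes "a \<in> finite_rank_ops" "is_svd a n e s" "\<And>i. 0 \<le> \<alpha> i" "n \<le> N" "0 < p"
  shows "choquet_trace \<alpha> (op_powr (op_abs a) p)
    = ennreal (\<Sum>i<N. (s i powr p - s (Suc i) powr p) * \<alpha> (Suc i))"
proof -
  note svd = is_svdD[OF assms(2)]
  have "antimono (\<lambda>i. s i powr p)"
    using svd(2,3) \<open>0 < p\<close> by (auto simp: antimono_def intro!: powr_mono2)
  then show ?thesis
    unfolding op_abs_eq_diag_op[OF assms(1,2)] op_powr_diag_op[OF svd(1)]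
    using svd assms(3-5) by (intro choquet_trace_diag_op) auto
qed

lemma is_svd_scaleC:
  assumes "is_svd a n e s"
  shows "is_svd (c *\<^sub>C a) n e (\<lambda>i. cmod c * s i)"
proof -
  have "cinner ((c *\<^sub>C a) x) ((c *\<^sub>C a) y)
      = cinner x (diag_op n e (\<lambda>i. (cmod c * s i)\<^sup>2) y)" for x y
  proof -
    have "diag_op n e (\<lambda>i. (cmod c * s i)\<^sup>2) y = (c * cnj c) *\<^sub>C diag_op n e (\<lambda>i. (s i)\<^sup>2) y"
      by (simp add: diag_op_def complex_vector.scale_sum_right scaleC_scaleC mult_cnj_cmod
          power_mult_distrib mult_ac)
    then show ?thesis
      using is_svdD(5)[OF assms] by (simp add: scaleC_fun_def cinner_linear mult_ac)
  qed
  with assms show ?thesis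
    by (auto simp: is_svd_def antimono_def mult_left_mono)
qed

section \<open>Variational bounds and the inequality for sums\<close>

lemma norm_svd:
  assumes "is_svd a n e s"
  shows "(norm (a x))\<^sup>2 = (\<Sum>i<n. (s i * cmod (cinner (e i) x))\<^sup>2)"
  using is_svdD(5)[OF assms] by (simp flip: Re_cinner_self add: Re_cinner_diag_op power_mult_distrib)

text \<open>Only coordinates with index at least \<open>i\<close> contribute, and their singular
  values are at most \<open>s i\<close>.\<close>

lemma norm_svd_le:
  assumes svd: "is_svd a n e s" and orth: "\<And>j. j < i \<Longrightarrow> j < n \<Longrightarrow> cinner (e j) x = 0"
  shows "norm (a x) \<le> s i * norm x"
proof -
  note svdD = is_svdD[OF svd]
  have "(s j * cmod (cinner (e j) x))\<^sup>2 \<le> (s i)\<^sup>2 * (cmod (cinner (e j) x))\<^sup>2" if "j < n" for j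
    using orth[of j] that svdD(2,3)
    by (cases "j < i") (auto simp: power_mult_distrib antimono_def intro!: mult_right_mono power_mono)
  then have "(norm (a x))\<^sup>2 \<le> (s i)\<^sup>2 * (\<Sum>j<n. (cmod (cinner (e j) x))\<^sup>2)"
    unfolding norm_svd[OF svd] sum_distrib_left by (intro sum_mono) auto
  also have "\<dots> \<le> (s i * norm x)\<^sup>2"
    unfolding power_mult_distrib by (intro mult_left_mono bessel svdD) auto
  finally show ?thesis using svdD(3)[of i] by (simp add: power2_le_iff_abs_le)
qed

text \<open>The opposite bound: only indices up to \<open>i\<close> contribute, with singular values
  at least \<open>s i\<close>.\<close>

lemma norm_svd_ge:
  assumes svd: "is_svd a n e s" and "i < n" and x: "x = (\<Sum>j<Suc i. c j *\<^sub>C e j)"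
  shows "s i * norm x \<le> norm (a x)"
proof -
  note svdD = is_svdD[OF svd]
  define d where "d j = (if j < Suc i then c j else 0)" for j
  have x: "x = (\<Sum>j<n. d j *\<^sub>C e j)"
    unfolding x d_def using \<open>i < n\<close> by (intro sum.mono_neutral_cong_left) auto
  have d: "cinner (e j) x = d j" if "j < n" for j
    unfolding x using that by (rule orthonormal_cinner_sum[OF svdD(1)])
  have "(s i * cmod (d j))\<^sup>2 \<le> (s j * cmod (d j))\<^sup>2" for j
    using svdD(2,3) by (auto simp: d_def antimono_def intro!: power_mono mult_right_mono)
  then have "(\<Sum>j<n. (s i * cmod (d j))\<^sup>2) \<le> (\<Sum>j<n. (s j * cmod (d j))\<^sup>2)" by (intro sum_mono)
  also have "\<dots> = (norm (a x))\<^sup>2" unfolding norm_svd[OF svd] using d by (intro sum.cong) auto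
  also have "(\<Sum>j<n. (s i * cmod (d j))\<^sup>2) = (s i * norm x)\<^sup>2"
    by (simp add: x norm_orthonormal_sum[OF svdD(1)] power_mult_distrib sum_distrib_left)
  finally show ?thesis by (rule power2_le_imp_le) simp
qed

text \<open>For \<open>T x = (\<Sum>u\<in>B. \<langle>u, x\<rangle> u)\<close> one has \<open>\<langle>x, T x\<rangle> = (\<Sum>u\<in>B. |\<langle>u, x\<rangle>|\<^sup>2)\<close>, so it suffices to make
  \<open>T x\<close> vanish, and the vectors \<open>T (g l)\<close> are too many to be independent.\<close>

lemma orthogonal_combination_exists:
  fixes g :: "nat \<Rightarrow> 'a::complex_hilbert"
  assumes "finite B" "card B < n"
  obtains c where "\<exists>l<n. c l \<noteq> 0" "\<And>u. u \<in> B \<Longrightarrow> cinner u (\<Sum>l<n. c l *\<^sub>C g l) = 0"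
proof -
  define T where "T x = (\<Sum>u\<in>B. (1 * cinner u x) *\<^sub>C u)" for x
  have T: "bounded_clinear T" unfolding T_def by (rule bounded_clinear_sum_cinner)
  have "\<exists>c. (\<exists>l<n. c l \<noteq> 0) \<and> (\<Sum>l<n. c l *\<^sub>C T (g l)) = 0"
  \<comment> \<open>Linear dependence is a notion for sets, so a repetition among the vectors
    \<open>T (g l)\<close> is treated apart.\<close>
  proof (cases "inj_on (\<lambda>l. T (g l)) {..<n}")
    case True
    let ?S = "(\<lambda>l. T (g l)) ` {..<n}"
    have "?S \<subseteq> cspan B"
      by (auto simp: T_def intro!: complex_vector.span_sum complex_vector.span_scale
          intro: complex_vector.span_base)
    moreover have "card ?S = n" using True by (simp add: card_image)
    ultimately have "complex_vector.dependent ?S"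
      using complex_vector.independent_span_bound[OF assms(1), of ?S] assms(2) by auto
    then obtain u v where "v \<in> ?S" "u v \<noteq> 0" "(\<Sum>v\<in>?S. u v *\<^sub>C v) = 0"
      by (auto simp: complex_vector.dependent_finite)
    with True show ?thesis
      by (intro exI[of _ "\<lambda>l. u (T (g l))"]) (auto simp: sum.reindex)
  next
    case False
    then obtain k l where kl: "k < n" "l < n" "k \<noteq> l" "T (g k) = T (g l)"
      by (auto simp: inj_on_def)
    define c :: "nat \<Rightarrow> complex" where "c j = (if j = k then 1 else 0) - (if j = l then 1 else 0)" for j
    have "(\<Sum>j<n. c j *\<^sub>C T (g j)) = T (g k) - T (g l)"
      using kl(1,2) by (simp add: c_def complex_vector.scale_left_diff_distrib sum_subtractf
          if_distrib[where f = "\<lambda>z. z *\<^sub>C _"] cong: if_cong)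
    with kl show ?thesis by (intro exI[of _ c]) (auto simp: c_def)
  qed
  then obtain c where c: "\<exists>l<n. c l \<noteq> 0" "(\<Sum>l<n. c l *\<^sub>C T (g l)) = 0" by blast
  define x where "x = (\<Sum>l<n. c l *\<^sub>C g l)"
  have "T x = 0" using c(2) by (simp add: x_def bounded_clinear_simps[OF T])
  moreover have "Re (cinner x (T x)) = (\<Sum>u\<in>B. (cmod (cinner u x))\<^sup>2)"
    unfolding T_def cinner_linear Re_sum
  proof (intro sum.cong refl)
    fix u
    show "Re (1 * cinner u x * cinner x u) = (cmod (cinner u x))\<^sup>2"
      by (subst cinner_commute[of x u]) (simp add: cmod_power2 flip: power2_eq_square)
  qed
  ultimately have "\<forall>u\<in>B. (cmod (cinner u x))\<^sup>2 = 0"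
    using assms(1) by (simp add: sum_nonneg_eq_0_iff)
  then show ?thesis using that c(1) by (simp add: x_def)
qed

text \<open>If the inequality failed, a vector in the span of the first \<open>i + j + 1\<close> right singular
  vectors of \<open>a + b\<close> that is orthogonal to the first \<open>i\<close> of \<open>a\<close> and the first \<open>j\<close> of \<open>b\<close> would
  violate the triangle inequality.\<close>

lemma singular_value_add_le:
  assumes a: "is_svd a n e s" and b: "is_svd b m f t" and ab: "is_svd (a + b) k g r"
  shows "r (i + j) \<le> s i + t j"
proof (cases "i + j < k")
  case True
  define B where "B = e ` {l. l < i \<and> l < n} \<union> f ` {l. l < j \<and> l < m}"
  have "card (e ` {l. l < i \<and> l < n}) \<le> i" "card (f ` {l. l < j \<and> l < m}) \<le> j"
    using surj_card_le[of "{..<i}" "e ` {l. l < i \<and> l < n}" e]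
      surj_card_le[of "{..<j}" "f ` {l. l < j \<and> l < m}" f] by auto
  then have "finite B" "card B < Suc (i + j)"
    unfolding B_def using card_Un_le[of "e ` {l. l < i \<and> l < n}" "f ` {l. l < j \<and> l < m}"] by auto
  then obtain c where c: "\<exists>l<Suc (i + j). c l \<noteq> 0"
    and orth: "\<And>u. u \<in> B \<Longrightarrow> cinner u (\<Sum>l<Suc (i + j). c l *\<^sub>C g l) = 0"
    using orthogonal_combination_exists[of B "Suc (i + j)" g] by metis
  define x where "x = (\<Sum>l<Suc (i + j). c l *\<^sub>C g l)"
  have "orthonormal (Suc (i + j)) g" using is_svdD(1)[OF ab] True by (auto simp: orthonormal_def)
  then have "(norm x)\<^sup>2 = (\<Sum>l<Suc (i + j). (cmod (c l))\<^sup>2)"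
    unfolding x_def by (rule norm_orthonormal_sum)
  moreover have "\<dots> \<noteq> 0"
    using c by (subst sum_nonneg_eq_0_iff) auto
  ultimately have "norm x > 0" by auto
  have "r (i + j) * norm x \<le> norm ((a + b) x)" using ab True x_def by (rule norm_svd_ge)
  also have "\<dots> \<le> norm (a x) + norm (b x)" by (simp add: norm_triangle_ineq)
  also have "norm (a x) \<le> s i * norm x" "norm (b x) \<le> t j * norm x"
    by (auto intro!: norm_svd_le[OF a] norm_svd_le[OF b] orth[folded x_def] simp: B_def)
  then have "norm (a x) + norm (b x) \<le> (s i + t j) * norm x" by (simp add: algebra_simps)
  finally show ?thesis using \<open>norm x > 0\<close> by simp
qed (use is_svdD(3)[OF a, of i] is_svdD(3)[OF b, of j] is_svdD(4)[OF ab, of "i + j"] in simp)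


section \<open>Choquet sums\<close>

text \<open>Truncation at \<open>N\<close>, exact for sequences that vanish from \<open>N\<close>
  on; it keeps the estimates in real arithmetic.\<close>

definition choquet_sum :: "(nat \<Rightarrow> real) \<Rightarrow> nat \<Rightarrow> (nat \<Rightarrow> real) \<Rightarrow> real" where
  "choquet_sum \<alpha> N s = (\<Sum>i<N. (s i - s (Suc i)) * \<alpha> (Suc i))"

lemma choquet_sum_nonneg:
  "antimono s \<Longrightarrow> (\<And>i. 0 \<le> \<alpha> i) \<Longrightarrow> 0 \<le> choquet_sum \<alpha> N s"
  unfolding choquet_sum_def by (intro sum_nonneg) (simp add: antimono_iff_le_Suc)

lemma choquet_sum_abel:
  assumes "\<alpha> 0 = 0" "s N = 0"
  shows "choquet_sum \<alpha> N s = (\<Sum>i<N. s i * (\<alpha> (Suc i) - \<alpha> i))"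
proof -
  have "choquet_sum \<alpha> N s = (\<Sum>i<N. s i * (\<alpha> (Suc i) - \<alpha> i)) - s N * \<alpha> N"
    using assms(1) by (induction N) (simp_all add: choquet_sum_def algebra_simps)
  with assms(2) show ?thesis by simp
qed

text \<open>Doubling compares values of \<open>\<alpha>\<close>, not increments. So the increments
  are first paired, then Abel summation for \<open>\<alpha> (2 * k)\<close> leads back to values,
  weighted by the nonnegative differences of \<open>u\<close>.\<close>

lemma choquet_sum_stretch:
  assumes u: "antimono u" "u N = 0" and \<alpha>: "\<alpha> 0 = 0" "\<And>n. 1 \<le> n \<Longrightarrow> \<alpha> (2 * n) \<le> C * \<alpha> n"
  shows "(\<Sum>i<2 * N. u (i div 2) * (\<alpha> (Suc i) - \<alpha> i)) \<le> C * choquet_sum \<alpha> N u"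
proof -
  have doubling: "\<alpha> (2 * Suc k) \<le> C * \<alpha> (Suc k)" for k by (rule \<alpha>(2)) simp
  have "(\<Sum>i<2 * N. u (i div 2) * (\<alpha> (Suc i) - \<alpha> i)) = (\<Sum>k<N. u k * (\<alpha> (2 * Suc k) - \<alpha> (2 * k)))"
    by (induction N) (simp_all add: algebra_simps)
  also have "\<dots> = choquet_sum (\<lambda>k. \<alpha> (2 * k)) N u"
    using u \<alpha>(1) by (subst choquet_sum_abel) simp_all
  also have "\<dots> \<le> (\<Sum>i<N. (u i - u (Suc i)) * (C * \<alpha> (Suc i)))"
    unfolding choquet_sum_def using u(1)
    by (intro sum_mono mult_left_mono doubling) (auto simp: antimono_iff_le_Suc)
  also have "\<dots> = C * choquet_sum \<alpha> N u"
    by (simp add: choquet_sum_def sum_distrib_left mult_ac)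
  finally show ?thesis .
qed

text \<open>A sum is at most twice the maximum; unlike convexity arguments this is uniform in
  p.\<close>

lemma add_powr_le:
  assumes "0 \<le> (x::real)" "0 \<le> y" "0 \<le> p"
  shows "(x + y) powr p \<le> 2 powr p * (x powr p + y powr p)"
proof -
  have "(x + y) powr p \<le> (2 * max x y) powr p" using assms by (intro powr_mono2) auto
  also have "\<dots> = 2 powr p * max x y powr p" using assms by (simp add: powr_mult)
  also have "max x y powr p \<le> x powr p + y powr p" by (simp add: max_def)
  finally show ?thesis by simp
qed

lemma antimono_powr:
  fixes s :: "nat \<Rightarrow> real"
  shows "antimono s \<Longrightarrow> (\<And>i. 0 \<le> s i) \<Longrightarrow> 0 \<le> p \<Longrightarrow> antimono (\<lambda>i. s i powr p)"
  by (auto simp: antimono_def intro!: powr_mono2)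

lemma choquet_sum_powr_le:
  assumes uvw: "\<And>i. w i \<le> u (i div 2) + v (i div 2)"
    and u: "antimono u" "\<And>i. 0 \<le> u i" "u N = 0" and v: "antimono v" "\<And>i. 0 \<le> v i" "v N = 0"
    and w: "\<And>i. 0 \<le> w i" "w (2 * N) = 0" and "0 < p"
    and \<alpha>: "mono \<alpha>" "\<alpha> 0 = 0" "\<And>n. 1 \<le> n \<Longrightarrow> \<alpha> (2 * n) \<le> C * \<alpha> n"
  shows "choquet_sum \<alpha> (2 * N) (\<lambda>i. w i powr p)
    \<le> 2 powr p * C * (choquet_sum \<alpha> N (\<lambda>i. u i powr p) + choquet_sum \<alpha> N (\<lambda>i. v i powr p))"
proof -
  have "choquet_sum \<alpha> (2 * N) (\<lambda>i. w i powr p) = (\<Sum>i<2 * N. w i powr p * (\<alpha> (Suc i) - \<alpha> i))"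
    using w(2) \<alpha>(2) by (intro choquet_sum_abel) simp_all
  also have "\<dots> \<le> (\<Sum>i<2 * N. 2 powr p * (u (i div 2) powr p + v (i div 2) powr p) * (\<alpha> (Suc i) - \<alpha> i))"
  proof (intro sum_mono mult_right_mono)
    fix i
    have "w i powr p \<le> (u (i div 2) + v (i div 2)) powr p"
      using uvw w(1) \<open>0 < p\<close> by (intro powr_mono2) auto
    also have "\<dots> \<le> 2 powr p * (u (i div 2) powr p + v (i div 2) powr p)"
      using u(2) v(2) \<open>0 < p\<close> by (intro add_powr_le) auto
    finally show "w i powr p \<le> 2 powr p * (u (i div 2) powr p + v (i div 2) powr p)" .
    show "0 \<le> \<alpha> (Suc i) - \<alpha> i" using \<alpha>(1) by (simp add: mono_iff_le_Suc)
  qed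
  also have "\<dots> = 2 powr p * ((\<Sum>i<2 * N. u (i div 2) powr p * (\<alpha> (Suc i) - \<alpha> i))
      + (\<Sum>i<2 * N. v (i div 2) powr p * (\<alpha> (Suc i) - \<alpha> i)))"
    by (simp add: sum_distrib_left distrib_left distrib_right mult.assoc flip: sum.distrib)
  also have "\<dots> \<le> 2 powr p * (C * choquet_sum \<alpha> N (\<lambda>i. u i powr p) + C * choquet_sum \<alpha> N (\<lambda>i. v i powr p))"
    using u v \<alpha>(2,3) \<open>0 < p\<close>
    by (intro mult_left_mono add_mono choquet_sum_stretch[where u = "\<lambda>i. _ i powr p"] antimono_powr) auto
  finally show ?thesis by (simp add: algebra_simps)
qed


section \<open>The equivalence\<close>

lemma ennreal_le_mult_add_iff:
  assumes "0 \<le> A" "0 \<le> B" "0 \<le> K"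
  shows "ennreal D \<le> ennreal K * (ennreal A + ennreal B) \<longleftrightarrow> D \<le> K * (A + B)"
  using assms by (simp add: ennreal_le_iff flip: ennreal_plus ennreal_mult')

lemma choquet_trace_op_powr:
  assumes "a \<in> finite_rank_ops" "is_svd a n e s" "\<And>i. 0 \<le> \<alpha> i" "n \<le> N" "0 < p"
  shows "choquet_trace \<alpha> (op_powr (op_abs a) p) = ennreal (choquet_sum \<alpha> N (\<lambda>i. s i powr p))"
    "0 \<le> choquet_sum \<alpha> N (\<lambda>i. s i powr p)"
proof -
  show "choquet_trace \<alpha> (op_powr (op_abs a) p) = ennreal (choquet_sum \<alpha> N (\<lambda>i. s i powr p))"
    unfolding choquet_sum_def using assms by (rule choquet_trace_svd)
  show "0 \<le> choquet_sum \<alpha> N (\<lambda>i. s i powr p)"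
    using is_svdD(2,3)[OF assms(2)] assms(3,5) by (intro choquet_sum_nonneg antimono_powr) auto
qed

lemma choquet_trace_add_le:
  assumes F: "a \<in> finite_rank_ops" "b \<in> finite_rank_ops" and "0 < p" "0 \<le> C"
    and \<alpha>: "\<And>n. 0 \<le> \<alpha> n" "mono \<alpha>" "\<alpha> 0 = 0" "\<And>n. 1 \<le> n \<Longrightarrow> \<alpha> (2 * n) \<le> C * \<alpha> n"
  shows "choquet_trace \<alpha> (op_powr (op_abs (a + b)) p)
    \<le> ennreal (2 powr p * C) *
      (choquet_trace \<alpha> (op_powr (op_abs a) p) + choquet_trace \<alpha> (op_powr (op_abs b) p))"
proof -
  have Fab: "a + b \<in> finite_rank_ops"
    using complex_vector.subspace_add[OF csubspace_finite_rank_ops] F by blast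
  obtain n e u where a: "is_svd a n e u" using svd_exists[OF F(1)] .
  obtain m f v where b: "is_svd b m f v" using svd_exists[OF F(2)] .
  obtain k g w where ab: "is_svd (a + b) k g w" using svd_exists[OF Fab] .
  define N where "N = n + m + k"
  have "w i \<le> u (i div 2) + v (i div 2)" for i
  proof -
    \<comment> \<open>For odd \<open>i\<close> halving loses one index, which monotonicity
      absorbs.\<close>
    have "w i \<le> w (i div 2 + i div 2)" using is_svdD(2)[OF ab] by (rule antimonoD) simp
    also have "\<dots> \<le> u (i div 2) + v (i div 2)" by (rule singular_value_add_le[OF a b ab])
    finally show ?thesis .
  qed
  then have "choquet_sum \<alpha> (2 * N) (\<lambda>i. w i powr p)
    \<le> 2 powr p * C * (choquet_sum \<alpha> N (\<lambda>i. u i powr p) + choquet_sum \<alpha> N (\<lambda>i. v i powr p))"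
    using is_svdD(2-4)[OF a] is_svdD(2-4)[OF b] is_svdD(3,4)[OF ab] \<alpha> \<open>0 < p\<close>
    by (intro choquet_sum_powr_le) (simp_all add: N_def)
  moreover have "n \<le> N" "m \<le> N" "k \<le> 2 * N" by (simp_all add: N_def)
  note choquet_trace_op_powr[where \<alpha> = \<alpha>, OF F(1) a \<alpha>(1) this(1) \<open>0 < p\<close>]
    choquet_trace_op_powr[where \<alpha> = \<alpha>, OF F(2) b \<alpha>(1) this(2) \<open>0 < p\<close>]
    choquet_trace_op_powr[where \<alpha> = \<alpha>, OF Fab ab \<alpha>(1) this(3) \<open>0 < p\<close>]
  ultimately show ?thesis
    using \<open>0 \<le> C\<close> by (simp only: ennreal_le_mult_add_iff mult_nonneg_nonneg powr_ge_zero)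
qed

section \<open>Quasi-norm properties of \<open>choquet_norm\<close>\<close>

lemma choquet_trace_finite:
  assumes "a \<in> finite_rank_ops" "\<And>n. 0 \<le> \<alpha> n" "0 < p"
  shows "choquet_trace \<alpha> (op_powr (op_abs a) p) = ennreal (enn2real (choquet_trace \<alpha> (op_powr (op_abs a) p)))"
proof -
  obtain n e s where "is_svd a n e s" using svd_exists[OF assms(1)] .
  then show ?thesis using choquet_trace_op_powr[OF assms(1) _ assms(2) order.refl assms(3)] by simp
qed

lemma choquet_norm_scaleC:
  assumes "a \<in> finite_rank_ops" "\<And>n. 0 \<le> \<alpha> n" "0 < p"
  shows "choquet_norm \<alpha> p (c *\<^sub>C a) = cmod c * choquet_norm \<alpha> p a"
proof -
  obtain n e s where svd: "is_svd a n e s" using svd_exists[OF assms(1)] .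
  have ca: "c *\<^sub>C a \<in> finite_rank_ops"
    using complex_vector.subspace_scale[OF csubspace_finite_rank_ops] assms(1) by blast
  have "choquet_sum \<alpha> n (\<lambda>i. (cmod c * s i) powr p) = cmod c powr p * choquet_sum \<alpha> n (\<lambda>i. s i powr p)"
    using is_svdD(3)[OF svd]
    by (simp add: choquet_sum_def sum_distrib_left powr_mult algebra_simps)
  then show ?thesis
    using choquet_trace_op_powr[OF assms(1) svd assms(2) order.refl assms(3)]
      choquet_trace_op_powr[OF ca is_svd_scaleC[OF svd] assms(2) order.refl assms(3)] assms(3)
    by (simp add: choquet_norm_def powr_mult powr_powr)
qed

lemma quasi_norm_choquet_norm:
  assumes \<alpha>: "\<And>n. 0 \<le> \<alpha> n" "mono \<alpha>" "\<alpha> 0 = 0" "\<And>n. 1 \<le> n \<Longrightarrow> \<alpha> (2 * n) \<le> C * \<alpha> n"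
    and "0 \<le> C" "0 < p"
  shows "quasi_norm_on (finite_rank_ops :: ('a::complex_hilbert \<Rightarrow> 'a) set) (choquet_norm \<alpha> p)"
proof -
  define K where "K = 2 powr p * C"
  have "0 \<le> K" using \<open>0 \<le> C\<close> by (simp add: K_def)
  \<comment> \<open>The product arises from taking the p-th root of \<open>K * (A + B)\<close> and
    splitting it by \<open>add_powr_le\<close> with exponent 1/p; the summand 2 forces
    \<open>c > 1\<close>.\<close>
  define c where "c = K powr (1 / p) * 2 powr (1 / p) + 2"
  have add: "choquet_norm \<alpha> p (a + b) \<le> c * (choquet_norm \<alpha> p a + choquet_norm \<alpha> p b)"
    if F: "a \<in> finite_rank_ops" "b \<in> finite_rank_ops" for a b :: "'a \<Rightarrow> 'a"
  proof -
    define A B D where "A = enn2real (choquet_trace \<alpha> (op_powr (op_abs a) p))"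
      and "B = enn2real (choquet_trace \<alpha> (op_powr (op_abs b) p))"
      and "D = enn2real (choquet_trace \<alpha> (op_powr (op_abs (a + b)) p))"
    have nonneg: "0 \<le> A" "0 \<le> B" "0 \<le> D" by (simp_all add: A_def B_def D_def)
    have Fab: "a + b \<in> finite_rank_ops"
      using complex_vector.subspace_add[OF csubspace_finite_rank_ops] F by blast
    have "ennreal D \<le> ennreal K * (ennreal A + ennreal B)"
      unfolding A_def B_def D_def K_def
      by (simp only: choquet_trace_finite[where \<alpha> = \<alpha>, OF F(1) \<alpha>(1) \<open>0 < p\<close>, symmetric]
          choquet_trace_finite[where \<alpha> = \<alpha>, OF F(2) \<alpha>(1) \<open>0 < p\<close>, symmetric]
          choquet_trace_finite[where \<alpha> = \<alpha>, OF Fab \<alpha>(1) \<open>0 < p\<close>, symmetric])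
         (intro choquet_trace_add_le F \<alpha> \<open>0 < p\<close> \<open>0 \<le> C\<close>)
    then have "D \<le> K * (A + B)"
      using nonneg \<open>0 \<le> K\<close> by (simp only: ennreal_le_mult_add_iff)
    then have "D powr (1 / p) \<le> (K * (A + B)) powr (1 / p)"
      using nonneg \<open>0 < p\<close> by (intro powr_mono2) auto
    also have "\<dots> = K powr (1 / p) * (A + B) powr (1 / p)"
      using nonneg \<open>0 \<le> K\<close> by (simp add: powr_mult)
    also have "\<dots> \<le> K powr (1 / p) * (2 powr (1 / p) * (A powr (1 / p) + B powr (1 / p)))"
      using nonneg \<open>0 < p\<close> by (intro mult_left_mono add_powr_le) auto
    also have "\<dots> \<le> c * (A powr (1 / p) + B powr (1 / p))"
      by (simp add: c_def algebra_simps)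
    finally show ?thesis by (simp add: choquet_norm_def A_def B_def D_def)
  qed
  have "0 \<le> K powr (1 / p) * 2 powr (1 / p)" by simp
  then have "1 < c" unfolding c_def by linarith
  with add choquet_norm_scaleC[OF _ \<alpha>(1) \<open>0 < p\<close>] show ?thesis
    unfolding quasi_norm_on_def by (intro exI[of _ c]) (auto simp: choquet_norm_def)
qed

section \<open>Doubling from pairs of orthogonal projections\<close>

lemma is_svd_proj_op:
  assumes e: "orthonormal n e"
  shows "is_svd (proj_op n e) n e (\<lambda>i. if i < n then 1 else 0)"
proof -
  have "proj_op n e (proj_op n e y) = diag_op n e (\<lambda>i. (if i < n then 1 else 0)\<^sup>2) y" for y
    unfolding diag_op_def[of n e "\<lambda>_. 1" "proj_op n e y"]
      diag_op_def[of n e "\<lambda>i. (if i < n then 1 else 0)\<^sup>2" y]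
    by (intro sum.cong) (simp_all add: cinner_diag_op[OF e])
  with e show ?thesis by (auto simp: is_svd_def antimono_def diag_op_selfadjoint)
qed

lemma choquet_trace_proj_op:
  assumes e: "orthonormal n e" and "1 \<le> n" "\<And>i. 0 \<le> \<alpha> i" "0 < p"
  shows "choquet_trace \<alpha> (op_powr (op_abs (proj_op n e)) p) = ennreal (\<alpha> n)"
proof -
  obtain m where n: "n = Suc m" using \<open>1 \<le> n\<close> by (cases n) auto
  \<comment> \<open>The 0-1 sequence drops only between \<open>m\<close> and \<open>Suc m\<close>,
    where the weight is \<open>\<alpha> n\<close>.\<close>
  have "choquet_sum \<alpha> n (\<lambda>i. (if i < n then 1 else 0) powr p) = \<alpha> n"
    by (simp add: choquet_sum_def n)
  then show ?thesis
    using choquet_trace_op_powr[OF diag_op_finite_rank is_svd_proj_op[OF e] assms(3) order.refl \<open>0 < p\<close>]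
    by simp
qed

lemma proj_op_double:
  "proj_op n e + proj_op n (\<lambda>i. e (n + i)) = proj_op (2 * n) (e :: nat \<Rightarrow> 'a::complex_hilbert)"
proof
  fix x
  have "sum f {..<2 * n} = sum f {..<n} + (\<Sum>i<n. f (n + i))" for f :: "nat \<Rightarrow> 'a"
    using sum.atLeastLessThan_concat[of 0 n "n + n" f] sum.shift_bounds_nat_ivl[of f 0 n n]
    by (simp add: lessThan_atLeast0 add.commute mult_2)
  then show "(proj_op n e + proj_op n (\<lambda>i. e (n + i))) x = proj_op (2 * n) e x"
    by (simp add: diag_op_def)
qed

lemma projection_pair_exists:
  assumes "\<not> (\<exists>B :: 'h::complex_hilbert set. finite B \<and> cspan B = UNIV)" and "1 \<le> n" "\<And>i. 0 \<le> \<alpha> i"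
  obtains a b :: "'h::complex_hilbert \<Rightarrow> 'h" where "a \<in> finite_rank_ops" "b \<in> finite_rank_ops"
    "\<forall>p>0. choquet_trace \<alpha> (op_powr (op_abs a) p) = ennreal (\<alpha> n)"
    "\<forall>p>0. choquet_trace \<alpha> (op_powr (op_abs b) p) = ennreal (\<alpha> n)"
    "\<forall>p>0. choquet_trace \<alpha> (op_powr (op_abs (a + b)) p) = ennreal (\<alpha> (2 * n))"
proof -
  obtain e :: "nat \<Rightarrow> 'h" where e: "orthonormal (2 * n) e" using orthonormal_exists[OF assms(1)] by blast
  then have "orthonormal n e" "orthonormal n (\<lambda>i. e (n + i))" by (auto simp: orthonormal_def)
  with e assms(2,3) show ?thesis
    by (intro that[of "proj_op n e" "proj_op n (\<lambda>i. e (n + i))"])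
       (simp_all add: diag_op_finite_rank choquet_trace_proj_op proj_op_double)
qed

lemma quasi_norm_on_triangle:
  assumes "quasi_norm_on X \<phi>"
  obtains c where "1 < c" "\<forall>x\<in>X. \<forall>y\<in>X. \<phi> (x + y) \<le> c * (\<phi> x + \<phi> y)"
  using assms unfolding quasi_norm_on_def by metis

lemma quasi_norm_imp_doubling:
  assumes "\<not> (\<exists>B :: 'h::complex_hilbert set. finite B \<and> cspan B = UNIV)"
    and \<alpha>: "\<And>i. 0 \<le> \<alpha> i" and "0 < p"
    and "quasi_norm_on (finite_rank_ops :: ('h \<Rightarrow> 'h) set) (choquet_norm \<alpha> p)"
  shows "\<exists>C. \<forall>n\<ge>1. \<alpha> (2 * n) \<le> C * \<alpha> n"
proof -
  obtain c where "1 < c" and c: "\<forall>a\<in>finite_rank_ops. \<forall>b\<in>finite_rank_ops :: ('h \<Rightarrow> 'h) set.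
      choquet_norm \<alpha> p (a + b) \<le> c * (choquet_norm \<alpha> p a + choquet_norm \<alpha> p b)"
    using quasi_norm_on_triangle[OF assms(4)] .
  \<comment> \<open>Both projections have the same quasi-norm, which gives \<open>2 * c\<close> for
    p-th roots; raising to the power p gives the constant.\<close>
  have "\<alpha> (2 * n) \<le> (2 * c) powr p * \<alpha> n" if n: "1 \<le> n" for n
  proof -
    obtain a b :: "'h \<Rightarrow> 'h" where ab: "a \<in> finite_rank_ops" "b \<in> finite_rank_ops"
      "\<forall>p>0. choquet_trace \<alpha> (op_powr (op_abs a) p) = ennreal (\<alpha> n)"
      "\<forall>p>0. choquet_trace \<alpha> (op_powr (op_abs b) p) = ennreal (\<alpha> n)"
      "\<forall>p>0. choquet_trace \<alpha> (op_powr (op_abs (a + b)) p) = ennreal (\<alpha> (2 * n))"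
      using projection_pair_exists[OF assms(1) n \<alpha>] .
    have "\<alpha> (2 * n) powr (1 / p) \<le> 2 * c * \<alpha> n powr (1 / p)"
      using bspec[OF bspec[OF c ab(1)] ab(2)] ab(3-5) \<open>0 < p\<close> \<alpha> by (simp add: choquet_norm_def mult_ac)
    then have "(\<alpha> (2 * n) powr (1 / p)) powr p \<le> (2 * c * \<alpha> n powr (1 / p)) powr p"
      using \<open>0 < p\<close> by (intro powr_mono2) auto
    then show ?thesis using \<open>0 < p\<close> \<open>1 < c\<close> \<alpha> by (simp add: powr_powr powr_mult)
  qed
  then show ?thesis by blast
qed

lemma bounded_ratio_iff:
  fixes \<alpha> :: "nat \<Rightarrow> real"
  assumes "\<And>n. 1 \<le> n \<Longrightarrow> 0 < \<alpha> n"
  shows "bounded ((\<lambda>n. \<alpha> (2 * n) / \<alpha> n) ` {1..}) \<longleftrightarrow> (\<exists>C. \<forall>n\<ge>1. \<alpha> (2 * n) \<le> C * \<alpha> n)"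
proof -
  have "norm (\<alpha> (2 * n) / \<alpha> n) \<le> C \<longleftrightarrow> \<alpha> (2 * n) \<le> C * \<alpha> n" if "1 \<le> n" for n C
    using assms[of n] assms[of "2 * n"] that by (simp add: divide_le_eq)
  then show ?thesis by (auto simp: bounded_iff)
qed

theorem theorem2p16:
  fixes \<alpha> :: "nat \<Rightarrow> real"
  assumes separable: "separable_space (euclidean :: 'h::complex_hilbert topology)"
    and infinite_dim: "\<not> (\<exists>B :: 'h set. finite B \<and> cspan B = UNIV)"
    and \<alpha>_nonneg: "\<And>n. 0 \<le> \<alpha> n"
    and \<alpha>_mono: "mono \<alpha>"
    and \<alpha>_0: "\<alpha> 0 = 0"
    and \<alpha>_1: "0 < \<alpha> 1"
  defines "F \<equiv> (finite_rank_ops :: ('h \<Rightarrow> 'h) set)"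
  defines "cond1 \<equiv> \<exists>M::real. 0 < M \<and> (\<forall>a\<in>F. \<forall>b\<in>F.
      choquet_trace \<alpha> (op_abs (a + b)) \<le>
        ennreal M * (choquet_trace \<alpha> (op_abs a) + choquet_trace \<alpha> (op_abs b)))"
    and "cond2 \<equiv> bounded ((\<lambda>n. \<alpha> (2 * n) / \<alpha> n) ` {1..})"
    and "cond3 \<equiv> \<forall>p\<ge>1. quasi_norm_on F (choquet_norm \<alpha> p)"
    and "cond4 \<equiv> \<forall>p. 0 < p \<and> p < 1 \<longrightarrow> quasi_norm_on F (choquet_norm \<alpha> p)"
    and "cond5 \<equiv> \<exists>p>0. quasi_norm_on F (choquet_norm \<alpha> p)"
  shows "(cond1 \<longleftrightarrow> cond2) \<and> (cond2 \<longleftrightarrow> cond3) \<and> (cond3 \<longleftrightarrow> cond4) \<and> (cond4 \<longleftrightarrow> cond5)"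
proof -
  have F_add: "a + b \<in> F" if "a \<in> F" "b \<in> F" for a b
    using complex_vector.subspace_add[OF csubspace_finite_rank_ops] that unfolding F_def by blast
  have \<alpha>_pos: "0 < \<alpha> n" if "1 \<le> n" for n
    using monoD[OF \<alpha>_mono that] \<alpha>_1 by linarith
  then have cond2_iff: "cond2 \<longleftrightarrow> (\<exists>C. \<forall>n\<ge>1. \<alpha> (2 * n) \<le> C * \<alpha> n)"
    unfolding cond2_def by (rule bounded_ratio_iff)
  have doubling: "\<exists>C>0. \<forall>n\<ge>1. \<alpha> (2 * n) \<le> C * \<alpha> n" if cond2
  proof -
    obtain C where "\<forall>n\<ge>1. \<alpha> (2 * n) \<le> C * \<alpha> n" using \<open>cond2\<close> cond2_iff by blast
    then have "\<alpha> (2 * n) \<le> max C 1 * \<alpha> n" if "1 \<le> n" for n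
      using that \<alpha>_nonneg[of n] by (meson max.cobounded1 mult_right_mono order.trans)
    \<comment> \<open>The maximum supplies the positivity that (1) demands of its constant.\<close>
    then show ?thesis by (intro exI[of _ "max C 1"]) auto
  qed
  have 21: cond1 if cond2
  proof -
    obtain C where C: "0 < C" "\<And>n. 1 \<le> n \<Longrightarrow> \<alpha> (2 * n) \<le> C * \<alpha> n" using doubling \<open>cond2\<close> by blast
    have "choquet_trace \<alpha> (op_abs (a + b))
        \<le> ennreal (2 * C) * (choquet_trace \<alpha> (op_abs a) + choquet_trace \<alpha> (op_abs b))"
      if "a \<in> F" "b \<in> F" for a b
      using choquet_trace_add_le[of a b 1 C \<alpha>] that F_add[OF that] C \<alpha>_nonneg \<alpha>_mono \<alpha>_0
      by (simp add: op_powr_1_op_abs F_def)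
    with C(1) show ?thesis unfolding cond1_def by (intro exI[of _ "2 * C"]) auto
  qed
  have 12: cond2 if cond1
  proof -
    obtain M where M: "0 < M" "\<And>a b. a \<in> F \<Longrightarrow> b \<in> F \<Longrightarrow> choquet_trace \<alpha> (op_abs (a + b))
        \<le> ennreal M * (choquet_trace \<alpha> (op_abs a) + choquet_trace \<alpha> (op_abs b))"
      using \<open>cond1\<close> unfolding cond1_def by blast
    have "\<alpha> (2 * n) \<le> 2 * M * \<alpha> n" if n: "1 \<le> n" for n
    proof -
      obtain a b :: "'h \<Rightarrow> 'h" where ab: "a \<in> F" "b \<in> F"
        "\<forall>p>0. choquet_trace \<alpha> (op_powr (op_abs a) p) = ennreal (\<alpha> n)"
        "\<forall>p>0. choquet_trace \<alpha> (op_powr (op_abs b) p) = ennreal (\<alpha> n)"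
        "\<forall>p>0. choquet_trace \<alpha> (op_powr (op_abs (a + b)) p) = ennreal (\<alpha> (2 * n))"
        using projection_pair_exists[OF infinite_dim n \<alpha>_nonneg] unfolding F_def .
      have "ennreal (\<alpha> (2 * n)) \<le> ennreal M * (ennreal (\<alpha> n) + ennreal (\<alpha> n))"
        using M(2)[OF ab(1,2)] spec[OF ab(3), of 1] spec[OF ab(4), of 1] spec[OF ab(5), of 1] ab(1,2) F_add[OF ab(1,2)]
        by (simp add: op_powr_1_op_abs F_def)
      then show ?thesis
        using \<alpha>_nonneg[of n] M(1) by (simp add: ennreal_le_mult_add_iff)
    qed
    then show ?thesis using cond2_iff by blast
  qed
  \<comment> \<open>(2) yields every exponent at once, hence (3) and (4); each of these contains an
    instance of (5), which leads back to (2).\<close>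
  have quasi: "quasi_norm_on F (choquet_norm \<alpha> p)" if cond2 "0 < p" for p
    using doubling[OF that(1)] quasi_norm_choquet_norm[OF \<alpha>_nonneg \<alpha>_mono \<alpha>_0 _ _ that(2)]
    unfolding F_def by (meson less_imp_le)
  have 52: cond2 if cond5
  proof -
    obtain p where p: "0 < p" "quasi_norm_on F (choquet_norm \<alpha> p)"
      using \<open>cond5\<close> unfolding cond5_def by blast
    show ?thesis
      unfolding cond2_iff using infinite_dim \<alpha>_nonneg p[unfolded F_def] by (rule quasi_norm_imp_doubling)
  qed
  have 35: cond5 if cond3 using that unfolding cond3_def cond5_def by (intro exI[of _ 1]) simp
  have 45: cond5 if cond4 using that unfolding cond4_def cond5_def by (intro exI[of _ "1/2"]) simp
  have 23: cond3 if cond2 using quasi[OF that] unfolding cond3_def by simp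
  have 24: cond4 if cond2 using quasi[OF that] unfolding cond4_def by simp
  show ?thesis using 12 21 52 35 45 23 24 by blast
qed

end
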